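(* Let $\mathbb{K}=\mathbb{R}$ or $\mathbb{C}$ and let $p\geq 1$ be an integer. Let $a_{i,j}$, $1\leq i,j\leq 2p$, be the standard coordinates (matrix entries) on the space $\mathbb{K}^{4p^2}$ of $2p\times 2p$ matrices over $\mathbb{K}$, and let $\omega$ be the Pfaffian form $$\omega=\sum_{i=1}^{2p}\sum_{j=1}^{p}\left(a_{i,2j}\,da_{i,2j-1}-a_{i,2j-1}\,da_{i,2j}\right).$$ Then $\omega$ induces (by restriction) a contact form on $SL(2p,\mathbb{K})=\{M=(a_{i,j}) : \det M=1\}$.
   Context: $SL(2p,\mathbb{K})$ is regarded as the hypersurface $\det M=1$ in $\mathbb{K}^{4p^2}$; it is a manifold of dimension $4p^2-1$ over $\mathbb{K}$ (a smooth manifold if $\mathbb{K}=\mathbb{R}$, a complex manifold if $\mathbb{K}=\mathbb{C}$, in which case forms are holomorphic). A Pfaffian form is a differential form of degree $1$. A contact form on a $(2m+1)$-dimensional manifold $V$ is a Pfaffian form $\alpha$ on $V$ such that $(\alpha\wedge(d\alpha)^m)(x)\neq 0$ for all $x\in V$. *)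

theory Defs
  imports "HOL-Analysis.Analysis" "HOL-Combinatorics.Permutations"
begin

text \<open>
  Everything is uniform in the ground field, which is meant to be \<^typ>\<open>real\<close> or
  \<^typ>\<open>complex\<close>.  The library notion of derivative is real-linear; since linearity over
  the ground field is demanded at each order, smoothness below means infinite differentiability
  over the reals and holomorphy over the complex numbers.
\<close>

primrec Ck_on :: "nat \<Rightarrow> ('k::real_normed_field ^ 'd::finite) set \<Rightarrow> ('k ^ 'd \<Rightarrow> 'k) \<Rightarrow> bool" where
  "Ck_on 0 U f \<longleftrightarrow> continuous_on U f"
| "Ck_on (Suc n) U f \<longleftrightarrow>
     (\<exists>f'. (\<forall>x\<in>U. (f has_derivative f' x) (at x) \<and> Vector_Spaces.linear (*s) (*) (f' x)) \<and>
           (\<forall>v. Ck_on n U (\<lambda>x. f' x v)))"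

definition smooth_on :: "('k::real_normed_field ^ 'd::finite) set \<Rightarrow> ('k ^ 'd \<Rightarrow> 'k) \<Rightarrow> bool" where
  "smooth_on U f \<longleftrightarrow> (\<forall>n. Ck_on n U f)"

definition smooth_map_on ::
  "('k::real_normed_field ^ 'd::finite) set \<Rightarrow> ('k ^ 'd \<Rightarrow> 'k ^ 'e::finite) \<Rightarrow> bool" where
  "smooth_map_on U \<phi> \<longleftrightarrow> (\<forall>i. smooth_on U (\<lambda>u. \<phi> u $ i))"


section \<open>Embedded submanifolds\<close>

definition local_param ::
  "('k::real_normed_field ^ 'e::finite) set \<Rightarrow> ('k ^ 'd::finite) set \<Rightarrow> ('k ^ 'd \<Rightarrow> 'k ^ 'e) \<Rightarrow> bool" where
  "local_param V U \<phi> \<longleftrightarrow>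
     open U \<and> smooth_map_on U \<phi> \<and>
     \<phi> ` U \<subseteq> V \<and> openin (top_of_set V) (\<phi> ` U) \<and>
     (\<exists>\<psi>. homeomorphism U (\<phi> ` U) \<phi> \<psi>) \<and>
     (\<forall>u\<in>U. inj (frechet_derivative \<phi> (at u)))"

text \<open>The type argument \<open>'d\<close> carries the dimension \<open>CARD('d)\<close> over the ground field.\<close>

definition submanifold :: "'d::finite itself \<Rightarrow> ('k::real_normed_field ^ 'e::finite) set \<Rightarrow> bool" where
  "submanifold TYPE('d) V \<longleftrightarrow>
     (\<forall>x\<in>V. \<exists>U (\<phi> :: 'k ^ 'd \<Rightarrow> 'k ^ 'e). local_param V U \<phi> \<and> x \<in> \<phi> ` U)"

definition tangent_space ::
  "'d::finite itself \<Rightarrow> ('k::real_normed_field ^ 'e::finite) set \<Rightarrow> 'k ^ 'e \<Rightarrow> ('k ^ 'e) set" where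
  "tangent_space TYPE('d) V x =
     {v. \<exists>U (\<phi> :: 'k ^ 'd \<Rightarrow> 'k ^ 'e) u. local_param V U \<phi> \<and> u \<in> U \<and> \<phi> u = x \<and>
           v \<in> range (frechet_derivative \<phi> (at u))}"


section \<open>Differential forms\<close>

text \<open>
  A form of degree \<open>k\<close> is a function \<open>\<alpha>\<close> such that \<open>\<alpha> x v\<close> is the value at the point \<open>x\<close>
  on the vectors \<open>v 0, \<dots>, v (k - 1)\<close>; further entries of \<open>v\<close> are irrelevant.  The degree is
  passed explicitly where it is needed.  For a form on a submanifold, only the values at points
  \<open>x\<close> of the submanifold and on vectors tangent at \<open>x\<close> are meaningful.
\<close>

type_synonym ('k, 'd) dform = "'k ^ 'd \<Rightarrow> (nat \<Rightarrow> 'k ^ 'd) \<Rightarrow> 'k"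

definition alternating_on ::
  "nat \<Rightarrow> ('k::real_normed_field ^ 'd::finite) set \<Rightarrow> ((nat \<Rightarrow> 'k ^ 'd) \<Rightarrow> 'k) \<Rightarrow> bool" where
  "alternating_on k T f \<longleftrightarrow>
     (\<forall>v w. (\<forall>i<k. v i = w i) \<longrightarrow> f v = f w) \<and>
     (\<forall>v i a b c. (\<forall>j<k. v j \<in> T) \<and> i < k \<and> a \<in> T \<and> b \<in> T \<longrightarrow>
        f (v(i := a + c *s b)) = f (v(i := a)) + c * f (v(i := b))) \<and>
     (\<forall>v i j. (\<forall>l<k. v l \<in> T) \<and> i < j \<and> j < k \<and> v i = v j \<longrightarrow> f v = 0)"

definition wedge ::
  "nat \<Rightarrow> nat \<Rightarrow> ('k::real_normed_field, 'd::finite) dform \<Rightarrow> ('k, 'd) dform \<Rightarrow> ('k, 'd) dform" where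
  "wedge k l \<alpha> \<beta> = (\<lambda>x v.
     (\<Sum>\<sigma> | \<sigma> permutes {..<k + l}.
        of_int (sign \<sigma>) * \<alpha> x (\<lambda>i. v (\<sigma> i)) * \<beta> x (\<lambda>i. v (\<sigma> (k + i)))) / (fact k * fact l))"

primrec wedge_pow ::
  "nat \<Rightarrow> ('k::real_normed_field, 'd::finite) dform \<Rightarrow> nat \<Rightarrow> ('k, 'd) dform" where
  "wedge_pow k \<alpha> 0 = (\<lambda>x v. 1)"
| "wedge_pow k \<alpha> (Suc m) = wedge k (k * m) \<alpha> (wedge_pow k \<alpha> m)"

definition pullback ::
  "('k::real_normed_field ^ 'd::finite \<Rightarrow> 'k ^ 'e::finite) \<Rightarrow> ('k, 'e) dform \<Rightarrow> ('k, 'd) dform" where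
  "pullback \<phi> \<alpha> = (\<lambda>u w. \<alpha> (\<phi> u) (\<lambda>i. frechet_derivative \<phi> (at u) (w i)))"

text \<open>The exterior derivative of a form of degree \<open>k\<close> on an open subset of the coordinate space.\<close>

definition ext_deriv ::
  "nat \<Rightarrow> ('k::real_normed_field, 'd::finite) dform \<Rightarrow> ('k, 'd) dform" where
  "ext_deriv k \<beta> = (\<lambda>x v.
     \<Sum>i\<le>k. (- 1) ^ i *
       frechet_derivative (\<lambda>y. \<beta> y (\<lambda>j. if j < i then v j else v (Suc j))) (at x) (v i))"

definition differential_form_on ::
  "'d::finite itself \<Rightarrow> nat \<Rightarrow> ('k::real_normed_field ^ 'e::finite) set \<Rightarrow> ('k, 'e) dform \<Rightarrow> bool" where
  "differential_form_on TYPE('d) k V \<alpha> \<longleftrightarrow>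
     (\<forall>x\<in>V. alternating_on k (tangent_space TYPE('d) V x) (\<alpha> x)) \<and>
     (\<forall>U (\<phi> :: 'k ^ 'd \<Rightarrow> 'k ^ 'e) w. local_param V U \<phi> \<longrightarrow> smooth_on U (\<lambda>u. pullback \<phi> \<alpha> u w))"

text \<open>
  The exterior derivative of a form \<open>\<alpha>\<close> of degree \<open>k\<close> on a submanifold is computed in any local
  parametrization \<open>\<phi>\<close>: it is the form on the submanifold whose pullback along \<open>\<phi>\<close> is the exterior
  derivative of the pullback of \<open>\<alpha>\<close>.
\<close>

definition ext_deriv_on ::
  "'d::finite itself \<Rightarrow> ('k::real_normed_field ^ 'e::finite) set \<Rightarrow> nat \<Rightarrow> ('k, 'e) dform \<Rightarrow> ('k, 'e) dform" where
  "ext_deriv_on TYPE('d) V k \<alpha> = (\<lambda>x v. THE c.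
     \<exists>U (\<phi> :: 'k ^ 'd \<Rightarrow> 'k ^ 'e) u w.
       local_param V U \<phi> \<and> u \<in> U \<and> \<phi> u = x \<and>
       (\<forall>i\<le>k. frechet_derivative \<phi> (at u) (w i) = v i) \<and>
       c = ext_deriv k (pullback \<phi> \<alpha>) u w)"

text \<open>The form of degree \<open>k\<close> that a form on the ambient space induces on a submanifold.\<close>

definition induced_form ::
  "'d::finite itself \<Rightarrow> nat \<Rightarrow> ('k::real_normed_field ^ 'e::finite) set \<Rightarrow> ('k, 'e) dform \<Rightarrow> ('k, 'e) dform" where
  "induced_form TYPE('d) k V \<omega> = (\<lambda>x v.
     if x \<in> V \<and> (\<forall>i<k. v i \<in> tangent_space TYPE('d) V x) then \<omega> x v else 0)"

definition contact_form ::
  "'d::finite itself \<Rightarrow> ('k::real_normed_field ^ 'e::finite) set \<Rightarrow> ('k, 'e) dform \<Rightarrow> bool" where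
  "contact_form TYPE('d) V \<alpha> \<longleftrightarrow>
     submanifold TYPE('d) V \<and>
     differential_form_on TYPE('d) 1 V \<alpha> \<and>
     (\<exists>m. CARD('d) = 2 * m + 1 \<and>
        (\<forall>x\<in>V. \<exists>v. (\<forall>i<2 * m + 1. v i \<in> tangent_space TYPE('d) V x) \<and>
           wedge 1 (2 * m) \<alpha> (wedge_pow 2 (ext_deriv_on TYPE('d) V 1 \<alpha>) m) x v \<noteq> 0))"


section \<open>The special linear group and the form\<close>

text \<open>
  Square matrices with rows and columns indexed by \<open>'n\<close> are points of the coordinate space indexed
  by \<open>'n \<times> 'n\<close>.
\<close>

definition SL :: "('k::real_normed_field ^ ('n::finite \<times> 'n)) set" where
  "SL = {a. det (\<chi> i j. a $ (i, j)) = 1}"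

definition dcoord :: "'d \<Rightarrow> ('k::real_normed_field, 'd::finite) dform" where
  "dcoord c = ext_deriv 0 (\<lambda>a _. a $ c)"

lemma dcoord_apply: "dcoord c a v = v 0 $ c"
proof -
  have "((\<lambda>y. y $ c) has_derivative (\<lambda>y. y $ c)) (at a)"
    by (rule bounded_linear_imp_has_derivative) (rule bounded_linear_vec_nth)
  then have "frechet_derivative (\<lambda>y. y $ c) (at a) = (\<lambda>y. y $ c)"
    by (rule frechet_derivative_at[symmetric])
  then show ?thesis
    by (simp add: dcoord_def ext_deriv_def)
qed

text \<open>The enumeration \<open>e\<close> turns the index type into \<open>{1..2 * p}\<close>.\<close>

definition omega ::
  "nat \<Rightarrow> (nat \<Rightarrow> 'n) \<Rightarrow> ('k::real_normed_field, 'n::finite \<times> 'n) dform" where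
  "omega p e = (\<lambda>a v.
     \<Sum>i = 1..2 * p. \<Sum>j = 1..p.
       a $ (e i, e (2 * j)) * dcoord (e i, e (2 * j - 1)) a v
       - a $ (e i, e (2 * j - 1)) * dcoord (e i, e (2 * j)) a v)"

end

theory Submission
  imports Defs
begin

text \<open>
  The form is \<open>\<omega>\<^sub>a(v) = B(a, v)\<close> for the skew-symmetric bilinear form \<open>B\<close> that is the standard symplectic
  form on each row of the matrix.  Hence \<open>d\<omega> = 2 B\<close> is a symplectic form on the space of all matrices, and
  \<open>\<omega>\<close> is, up to a factor, its contraction with the radial field \<open>a \<mapsto> a\<close>.  A hypersurface to which the
  radial field is transversal inherits a contact form.  The hypersurface \<open>det = 1\<close> is such: \<open>det\<close> is
  homogeneous, so that by Euler's identity its differential at \<open>x\<close> takes the value \<open>2 p det x \<noteq> 0\<close> on \<open>x\<close>.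

  In coordinates, represent the differential of \<open>det\<close> at \<open>x\<close> as \<open>B(n, \<cdot>)\<close>.  The tangent space is the
  \<open>B\<close>-orthogonal complement of \<open>n\<close>, and Euler's identity says \<open>B(x, n) \<noteq> 0\<close>.  So \<open>x\<close> and a multiple of \<open>n\<close>
  form a hyperbolic pair, which extends to a symplectic basis \<open>b\<^sub>0 = x, b\<^sub>1, \<dots>\<close> of the whole space
  (\<open>symplectic_basis_through_SL_point\<close>).  All of \<open>b\<^sub>1, b\<^sub>2, \<dots>\<close> are tangent, and \<open>\<omega> \<and> (d\<omega>)\<^sup>m\<close> is evaluated on
  them.  By the definition of the wedge product this is a sum over permutations; each summand is, up to a
  common positive factor, the sign of the permutation times a product of entries of the standard symplectic
  matrix.  Such a product is \<open>0\<close> or equal to the sign (\<open>symplectic_permutation_product\<close>), because a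
  permutation that preserves a partition into pairs has the sign given by the number of pairs that it
  reverses.  So no summand is negative, the identity contributes a positive one, and the sum is a nonzero
  integer (\<open>contact_product_on_symplectic_basis\<close>).

  What remains is to identify the objects on the submanifold.  The determinant is affine in each single entry,
  so where a cofactor is nonzero the equation \<open>det = 1\<close> can be solved rationally for that entry; these graphs
  are the charts (\<open>SL_chart_local_param\<close>) and give the tangent space (\<open>tangent_space_SL\<close>).  The exterior
  derivative in an arbitrary parametrization is \<open>2 B\<close> because the terms with second derivatives of the
  parametrization cancel by symmetry (\<open>second_derivative_symmetric\<close>, \<open>ext_deriv_pullback_omega\<close>).

  All arguments work over any normed field extending the reals, which covers both ground fields at once.
\<close>

section \<open>Calculus in normed spaces\<close>

text \<open>
  The increment of \<open>f\<close> over a small parallelogram, as a function of one side, has derivative close to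
  \<open>h\<close> times \<open>A b\<close>; the mean value inequality then gives the estimate.
\<close>

lemma mixed_difference_quotient:
  fixes f :: "'a::real_normed_vector \<Rightarrow> 'b::real_normed_vector"
  assumes U: "open U" "x \<in> U"
    and f': "\<And>y. y \<in> U \<Longrightarrow> (f has_derivative f' y) (at y)"
    and A: "((\<lambda>y. f' y a) has_derivative A) (at x)"
    and "\<epsilon> > 0"
  shows "\<exists>\<delta>>0. \<forall>h. 0 < h \<and> h < \<delta> \<longrightarrow>
    norm (f (x + h *\<^sub>R a + h *\<^sub>R b) - f (x + h *\<^sub>R a) - f (x + h *\<^sub>R b) + f x - h\<^sup>2 *\<^sub>R A b) \<le> \<epsilon> * h\<^sup>2"
proof -
  \<comment> \<open>All points of the parallelogram have distance at most \<open>h M\<close> from \<open>x\<close>.\<close>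
  define M where "M = norm a + norm b + 1"
  have M: "M > 0" by (simp add: M_def add_nonneg_pos)
  define e where "e = \<epsilon> / (2 * M)"
  have e: "e > 0" using M \<open>\<epsilon> > 0\<close> by (simp add: e_def)
  interpret A: bounded_linear A using A by (rule has_derivative_bounded_linear)
  obtain d1 where d1: "d1 > 0" "\<And>y. norm (y - x) < d1 \<Longrightarrow> norm (f' y a - f' x a - A (y - x)) \<le> e * norm (y - x)"
    using A e unfolding has_derivative_at_alt by blast
  obtain d2 where d2: "d2 > 0" "\<And>y. norm (y - x) < d2 \<Longrightarrow> y \<in> U"
    using U unfolding open_dist by (metis dist_norm)
  define \<delta> where "\<delta> = min d1 d2 / M"
  have "\<delta> > 0" using d1 d2 M by (simp add: \<delta>_def)
  moreover have "norm (f (x + h *\<^sub>R a + h *\<^sub>R b) - f (x + h *\<^sub>R a) - f (x + h *\<^sub>R b) + f x - h\<^sup>2 *\<^sub>R A b) \<le> \<epsilon> * h\<^sup>2"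
    if h: "0 < h" "h < \<delta>" for h
  proof -
    have hM: "h * M < d1" "h * M < d2"
      using h M by (auto simp: \<delta>_def field_simps)
    have near: "norm (s *\<^sub>R a + t *\<^sub>R b) \<le> h * M" if "s \<in> {0..h}" "t \<in> {0..h}" for s t
    proof -
      have "norm (s *\<^sub>R a + t *\<^sub>R b) \<le> s * norm a + t * norm b"
        using that by (intro norm_triangle_le) auto
      also have "\<dots> \<le> h * norm a + h * norm b"
        using that by (intro add_mono mult_right_mono) auto
      also have "\<dots> \<le> h * M" using h by (simp add: M_def algebra_simps)
      finally show ?thesis .
    qed
    \<comment> \<open>One side of the parallelogram varies with \<open>s\<close>; subtracting the expected value makes the derivative small.\<close>
    define k where "k s = f (x + s *\<^sub>R a + h *\<^sub>R b) - f (x + s *\<^sub>R a) - (s * h) *\<^sub>R A b" for s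
    define k' where "k' s t = f' (x + s *\<^sub>R a + h *\<^sub>R b) (t *\<^sub>R a) - f' (x + s *\<^sub>R a) (t *\<^sub>R a) - (t * h) *\<^sub>R A b" for s t
    have "norm (k h - k 0) \<le> (\<epsilon> * h) * norm (h - 0)"
    proof (rule differentiable_bound[of "{0..h}" k k'])
      fix s assume s: "s \<in> {0..h}"
      let ?y = "x + s *\<^sub>R a + h *\<^sub>R b" and ?z = "x + s *\<^sub>R a"
      have ny: "norm (?y - x) \<le> h * M" using near[of s h] s h by simp
      have nz: "norm (?z - x) \<le> h * M" using near[of s 0] s h by simp
      have yU: "?y \<in> U" and zU: "?z \<in> U" using d2 ny nz hM by force+
      have dy: "((\<lambda>s. f (x + s *\<^sub>R a + h *\<^sub>R b)) has_derivative (\<lambda>t. f' ?y (t *\<^sub>R a))) (at s within {0..h})"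
        by (rule has_derivative_compose[of "\<lambda>s. x + s *\<^sub>R a + h *\<^sub>R b" _ _ _ f, OF _ f'[OF yU]])
           (auto intro!: derivative_eq_intros)
      have dz: "((\<lambda>s. f (x + s *\<^sub>R a)) has_derivative (\<lambda>t. f' ?z (t *\<^sub>R a))) (at s within {0..h})"
        by (rule has_derivative_compose[of "\<lambda>s. x + s *\<^sub>R a" _ _ _ f, OF _ f'[OF zU]])
           (auto intro!: derivative_eq_intros)
      show "(k has_derivative k' s) (at s within {0..h})"
        unfolding k_def k'_def by (intro has_derivative_diff dy dz) (auto intro!: derivative_eq_intros)
      show "onorm (k' s) \<le> \<epsilon> * h"
      proof (rule onorm_le)
        fix t :: real
        interpret ly: bounded_linear "f' ?y" using f'[OF yU] by (rule has_derivative_bounded_linear)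
        interpret lz: bounded_linear "f' ?z" using f'[OF zU] by (rule has_derivative_bounded_linear)
        have k't: "k' s t = t *\<^sub>R ((f' ?y a - f' x a - A (?y - x)) - (f' ?z a - f' x a - A (?z - x)))"
          unfolding k'_def ly.scaleR lz.scaleR by (simp add: A.add A.scaleR algebra_simps)
        have "norm (k' s t) \<le> \<bar>t\<bar> * (e * (h * M) + e * (h * M))"
        proof -
          have "norm (f' ?y a - f' x a - A (?y - x)) \<le> e * (h * M)"
            by (rule order_trans[OF d1(2)]) (use ny hM e in \<open>auto intro!: mult_left_mono\<close>)
          moreover have "norm (f' ?z a - f' x a - A (?z - x)) \<le> e * (h * M)"
            by (rule order_trans[OF d1(2)]) (use nz hM e in \<open>auto intro!: mult_left_mono\<close>)
          ultimately have "norm ((f' ?y a - f' x a - A (?y - x)) - (f' ?z a - f' x a - A (?z - x))) \<le> e * (h * M) + e * (h * M)"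
            by (rule order_trans[OF norm_triangle_ineq4 add_mono])
          then show ?thesis unfolding k't by (simp only: norm_scaleR) (intro mult_left_mono; simp)
        qed
        also have "e * (h * M) + e * (h * M) = \<epsilon> * h"
          using M by (simp add: e_def field_simps)
        finally show "norm (k' s t) \<le> \<epsilon> * h * norm t" by (simp add: mult.commute)
      qed
    qed (use h in auto)
    moreover have "k h - k 0 = f (x + h *\<^sub>R a + h *\<^sub>R b) - f (x + h *\<^sub>R a) - f (x + h *\<^sub>R b) + f x - h\<^sup>2 *\<^sub>R A b"
      by (simp add: k_def power2_eq_square)
    ultimately show ?thesis using h by (simp add: power2_eq_square)
  qed
  ultimately show ?thesis by blast
qed

text \<open>
  The increment over the parallelogram is symmetric in \<open>a\<close> and \<open>b\<close>, so both mixed second derivatives are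
  its limit after division by \<open>h\<^sup>2\<close>.
\<close>

lemma second_derivative_symmetric:
  fixes f :: "'a::real_normed_vector \<Rightarrow> 'b::real_normed_vector"
  assumes U: "open U" "x \<in> U"
    and f': "\<And>y. y \<in> U \<Longrightarrow> (f has_derivative f' y) (at y)"
    and A: "((\<lambda>y. f' y a) has_derivative A) (at x)"
    and B: "((\<lambda>y. f' y b) has_derivative B) (at x)"
  shows "A b = B a"
proof (rule ccontr)
  assume "A b \<noteq> B a"
  define \<epsilon> where "\<epsilon> = norm (A b - B a) / 3"
  have \<epsilon>: "\<epsilon> > 0" using \<open>A b \<noteq> B a\<close> by (simp add: \<epsilon>_def)
  let ?\<Delta> = "\<lambda>h. f (x + h *\<^sub>R a + h *\<^sub>R b) - f (x + h *\<^sub>R a) - f (x + h *\<^sub>R b) + f x"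
  obtain d1 where d1: "d1 > 0" "\<And>h. 0 < h \<Longrightarrow> h < d1 \<Longrightarrow> norm (?\<Delta> h - h\<^sup>2 *\<^sub>R A b) \<le> \<epsilon> * h\<^sup>2"
    using mixed_difference_quotient[OF U f' A \<epsilon>, of b] by blast
  obtain d2 where d2: "d2 > 0" "\<And>h. 0 < h \<Longrightarrow> h < d2 \<Longrightarrow> norm (?\<Delta> h - h\<^sup>2 *\<^sub>R B a) \<le> \<epsilon> * h\<^sup>2"
    using mixed_difference_quotient[OF U f' B \<epsilon>, of a] by (auto simp: algebra_simps)
  obtain h where h: "0 < h" "h < d1" "h < d2" using d1(1) d2(1) by (meson field_lbound_gt_zero)
  have "h\<^sup>2 *\<^sub>R (A b - B a) = (?\<Delta> h - h\<^sup>2 *\<^sub>R B a) - (?\<Delta> h - h\<^sup>2 *\<^sub>R A b)"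
    by (simp add: algebra_simps)
  also have "norm \<dots> \<le> \<epsilon> * h\<^sup>2 + \<epsilon> * h\<^sup>2"
    using d1(2) d2(2) h by (intro order_trans[OF norm_triangle_ineq4 add_mono]) auto
  finally have "h\<^sup>2 * norm (A b - B a) \<le> h\<^sup>2 * (2 * \<epsilon>)" by (simp add: mult.commute)
  then have "h\<^sup>2 * (3 * \<epsilon>) \<le> h\<^sup>2 * (2 * \<epsilon>)" by (simp add: \<epsilon>_def)
  then show False using h \<epsilon> by (simp add: mult_le_cancel_left_pos)
qed

lemma has_derivative_vecI:
  fixes f :: "'a::real_normed_vector \<Rightarrow> 'b::real_normed_vector ^ 'n::finite"
  assumes d: "\<And>i. ((\<lambda>x. f x $ i) has_derivative (\<lambda>h. f' h $ i)) (at x)"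
  shows "(f has_derivative f') (at x)"
  unfolding has_derivative_at
proof
  have "\<And>i. bounded_linear (\<lambda>h. f' h $ i)" using d by (rule has_derivative_bounded_linear)
  then obtain K where K: "\<And>i h. norm (f' h $ i) \<le> norm h * K i"
    unfolding bounded_linear_def bounded_linear_axioms_def by metis
  show "bounded_linear f'"
  proof (rule bounded_linear_intro)
    fix h k :: 'a and r :: real
    note lin = bounded_linear.linear[OF \<open>\<And>i. bounded_linear (\<lambda>h. f' h $ i)\<close>]
    show "f' (h + k) = f' h + f' k"
      using linear_add[OF lin] by (simp add: vec_eq_iff)
    show "f' (r *\<^sub>R h) = r *\<^sub>R f' h"
      using linear_scale[OF lin] by (simp add: vec_eq_iff)
    have "norm (f' h) \<le> (\<Sum>i\<in>UNIV. norm (f' h $ i))"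
      unfolding norm_vec_def by (rule L2_set_le_sum) simp
    also have "\<dots> \<le> (\<Sum>i\<in>UNIV. norm h * K i)" by (rule sum_mono) (rule K)
    also have "\<dots> = norm h * (\<Sum>i\<in>UNIV. K i)" by (simp add: sum_distrib_left)
    finally show "norm (f' h) \<le> norm h * (\<Sum>i\<in>UNIV. K i)" .
  qed
  have lim: "((\<lambda>h. (f (x + h) $ i - f x $ i - f' h $ i) /\<^sub>R norm h) \<longlongrightarrow> 0) (at 0)" for i
  proof (rule tendsto_norm_zero_cancel)
    show "(\<lambda>h. norm ((f (x + h) $ i - f x $ i - f' h $ i) /\<^sub>R norm h)) \<midarrow>0\<rightarrow> 0"
      using d[of i] unfolding has_derivative_at by (simp add: divide_inverse mult.commute)
  qed
  show "(\<lambda>h. norm (f (x + h) - f x - f' h) / norm h) \<midarrow>0\<rightarrow> 0"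
  proof -
    have "(\<lambda>h. (f (x + h) - f x - f' h) /\<^sub>R norm h) \<midarrow>0\<rightarrow> 0"
      by (rule vec_tendstoI) (simp add: lim)
    then have "(\<lambda>h. norm ((f (x + h) - f x - f' h) /\<^sub>R norm h)) \<midarrow>0\<rightarrow> 0"
      by (rule tendsto_norm_zero)
    then show ?thesis by (simp add: divide_inverse mult.commute)
  qed
qed

section \<open>Smooth functions and local parametrizations\<close>

lemma scalar_linear_plus:
  fixes f g :: "'k::real_normed_field ^ 'd::finite \<Rightarrow> 'k"
  assumes "Vector_Spaces.linear (*s) (*) f" "Vector_Spaces.linear (*s) (*) g"
  shows "Vector_Spaces.linear (*s) (*) (\<lambda>v. c * f v + d * g v)"
proof -
  interpret f: Vector_Spaces.linear "(*s)" "(*)" f by fact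
  interpret g: Vector_Spaces.linear "(*s)" "(*)" g by fact
  show ?thesis
    by unfold_locales (simp_all add: f.add g.add f.scale g.scale algebra_simps)
qed

lemma scalar_linear_zero: "Vector_Spaces.linear (*s) (*) (\<lambda>v::'k::real_normed_field ^ 'd::finite. 0::'k)"
  by unfold_locales (simp_all add: algebra_simps)

lemma scalar_linear_nth: "Vector_Spaces.linear (*s) (*) (\<lambda>v::'k::real_normed_field ^ 'd::finite. v $ i)"
  by unfold_locales (simp_all add: algebra_simps)

text \<open>
  The closure properties of \<^const>\<open>Ck_on\<close> are proved by induction on the order.  The derivative of a product
  or of an inverse involves the functions themselves again, at an order lower by one, which is why monotonicity
  in the order is needed there.
\<close>

lemma Ck_on_mono: "Ck_on (Suc n) U f \<Longrightarrow> Ck_on n U f"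
proof (induction n arbitrary: f)
  case 0
  then obtain f' where "\<And>x. x \<in> U \<Longrightarrow> (f has_derivative f' x) (at x)"
    by auto
  then show ?case
    by (auto intro!: continuous_at_imp_continuous_on dest: has_derivative_continuous)
next
  case (Suc n)
  obtain f' where f': "\<And>x. x\<in>U \<Longrightarrow> (f has_derivative f' x) (at x) \<and> Vector_Spaces.linear (*s) (*) (f' x)"
    "\<And>v. Ck_on (Suc n) U (\<lambda>x. f' x v)"
    using Suc.prems unfolding Ck_on.simps(2)[of "Suc n"] by blast
  then show ?case unfolding Ck_on.simps(2)[of n] using f'(1) Suc.IH[OF f'(2)] by blast
qed

lemma Ck_on_const: "Ck_on n U (\<lambda>x. c)"
proof (induction n arbitrary: c)
  case (Suc n)
  show ?case unfolding Ck_on.simps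
    by (rule exI[of _ "\<lambda>x v. 0"]) (simp add: Suc scalar_linear_zero)
qed simp

lemma Ck_on_nth: "Ck_on n U (\<lambda>x. x $ i)"
proof (cases n)
  case 0
  then show ?thesis by (auto intro!: continuous_intros)
next
  case (Suc n)
  show ?thesis unfolding Ck_on.simps Suc
    by (rule exI[of _ "\<lambda>x v. v $ i"])
      (auto simp: Ck_on_const scalar_linear_nth intro!: bounded_linear_imp_has_derivative)
qed

lemma Ck_on_add: "Ck_on n U f \<Longrightarrow> Ck_on n U g \<Longrightarrow> Ck_on n U (\<lambda>x. f x + g x)"
proof (induction n arbitrary: f g)
  case 0
  then show ?case by (auto intro!: continuous_intros)
next
  case (Suc n)
  obtain f' where f': "\<And>x. x\<in>U \<Longrightarrow> (f has_derivative f' x) (at x) \<and> Vector_Spaces.linear (*s) (*) (f' x)"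
    "\<And>v. Ck_on n U (\<lambda>x. f' x v)"
    using Suc.prems(1) unfolding Ck_on.simps by blast
  obtain g' where g': "\<And>x. x\<in>U \<Longrightarrow> (g has_derivative g' x) (at x) \<and> Vector_Spaces.linear (*s) (*) (g' x)"
    "\<And>v. Ck_on n U (\<lambda>x. g' x v)"
    using Suc.prems(2) unfolding Ck_on.simps by blast
  show ?case unfolding Ck_on.simps
  proof (intro exI[of _ "\<lambda>x v. f' x v + g' x v"] conjI ballI allI)
    fix x assume "x \<in> U"
    then show "((\<lambda>x. f x + g x) has_derivative (\<lambda>v. f' x v + g' x v)) (at x)"
      using f' g' by (auto intro!: has_derivative_add)
    show "Vector_Spaces.linear (*s) (*) (\<lambda>v. f' x v + g' x v)"
      using scalar_linear_plus[of "f' x" "g' x" 1 1] f' g' \<open>x \<in> U\<close> by simp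
  qed (use Suc.IH f' g' in auto)
qed

lemma Ck_on_mult: "Ck_on n U f \<Longrightarrow> Ck_on n U g \<Longrightarrow> Ck_on n U (\<lambda>x. f x * g x)"
proof (induction n arbitrary: f g)
  case 0
  then show ?case by (auto intro!: continuous_intros)
next
  case (Suc n)
  obtain f' where f': "\<And>x. x\<in>U \<Longrightarrow> (f has_derivative f' x) (at x) \<and> Vector_Spaces.linear (*s) (*) (f' x)"
    "\<And>v. Ck_on n U (\<lambda>x. f' x v)"
    using Suc.prems(1) unfolding Ck_on.simps by blast
  obtain g' where g': "\<And>x. x\<in>U \<Longrightarrow> (g has_derivative g' x) (at x) \<and> Vector_Spaces.linear (*s) (*) (g' x)"
    "\<And>v. Ck_on n U (\<lambda>x. g' x v)"
    using Suc.prems(2) unfolding Ck_on.simps by blast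
  show ?case unfolding Ck_on.simps
  proof (intro exI[of _ "\<lambda>x v. f x * g' x v + f' x v * g x"] conjI ballI allI)
    fix x assume "x \<in> U"
    then show "((\<lambda>x. f x * g x) has_derivative (\<lambda>v. f x * g' x v + f' x v * g x)) (at x)"
      using f' g' by (auto intro!: has_derivative_mult)
    show "Vector_Spaces.linear (*s) (*) (\<lambda>v. f x * g' x v + f' x v * g x)"
      using scalar_linear_plus[of "g' x" "f' x" "f x" "g x"] f' g' \<open>x \<in> U\<close> by (simp add: mult.commute)
  next
    show "Ck_on n U (\<lambda>x. f x * g' x v + f' x v * g x)" for v
      using Suc.prems[THEN Ck_on_mono] f'(2) g'(2) by (intro Ck_on_add Suc.IH)
  qed
qed

lemma Ck_on_diff: "Ck_on n U f \<Longrightarrow> Ck_on n U g \<Longrightarrow> Ck_on n U (\<lambda>x. f x - g x)"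
  using Ck_on_add[of n U f "\<lambda>x. (-1) * g x"] Ck_on_mult[OF Ck_on_const[of n U "-1"], of g] by simp

lemma Ck_on_inverse:
  assumes "\<And>x. x \<in> U \<Longrightarrow> f x \<noteq> 0"
  shows "Ck_on n U f \<Longrightarrow> Ck_on n U (\<lambda>x. inverse (f x))"
proof (induction n)
  case 0
  then show ?case using assms by (auto intro!: continuous_intros)
next
  case (Suc n)
  obtain f' where f': "\<And>x. x\<in>U \<Longrightarrow> (f has_derivative f' x) (at x) \<and> Vector_Spaces.linear (*s) (*) (f' x)"
    "\<And>v. Ck_on n U (\<lambda>x. f' x v)"
    using Suc.prems(1) unfolding Ck_on.simps by blast
  have IH: "Ck_on n U (\<lambda>x. inverse (f x))" using Suc Ck_on_mono by blast
  show ?case unfolding Ck_on.simps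
  proof (intro exI[of _ "\<lambda>x v. (-1) * (inverse (f x) * f' x v * inverse (f x))"] conjI ballI allI)
    fix x assume x: "x \<in> U"
    then show "((\<lambda>x. inverse (f x)) has_derivative (\<lambda>v. (-1) * (inverse (f x) * f' x v * inverse (f x)))) (at x)"
      using f' assms by (auto intro!: derivative_eq_intros)
    show "Vector_Spaces.linear (*s) (*) (\<lambda>v. (-1) * (inverse (f x) * f' x v * inverse (f x)))"
      using scalar_linear_plus[of "f' x" "f' x" "- (inverse (f x) * inverse (f x))" 0] f' \<open>x \<in> U\<close>
      by (simp add: ac_simps)
  next
    show "Ck_on n U (\<lambda>x. (-1) * (inverse (f x) * f' x v * inverse (f x)))" for v
      using IH f' by (intro Ck_on_mult Ck_on_const)
  qed
qed

lemma Ck_on_sum: "(\<And>i. i \<in> I \<Longrightarrow> Ck_on n U (f i)) \<Longrightarrow> Ck_on n U (\<lambda>x. \<Sum>i\<in>I. f i x)"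
proof (induction I rule: infinite_finite_induct)
  case (insert i I)
  then have "Ck_on n U (f i)" "Ck_on n U (\<lambda>x. \<Sum>i\<in>I. f i x)" by blast+
  from Ck_on_add[OF this] show ?case by (simp only: sum.insert[OF insert(1,2)])
qed (simp_all add: Ck_on_const)

lemma Ck_on_prod: "(\<And>i. i \<in> I \<Longrightarrow> Ck_on n U (f i)) \<Longrightarrow> Ck_on n U (\<lambda>x. \<Prod>i\<in>I. f i x)"
proof (induction I rule: infinite_finite_induct)
  case (insert i I)
  then have "Ck_on n U (f i)" "Ck_on n U (\<lambda>x. \<Prod>i\<in>I. f i x)" by blast+
  from Ck_on_mult[OF this] show ?case by (simp only: prod.insert[OF insert(1,2)])
qed (simp_all add: Ck_on_const)

lemma Ck_on_cong:
  assumes "open U" "\<And>x. x \<in> U \<Longrightarrow> f x = g x" "Ck_on n U f"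
  shows "Ck_on n U g"
proof (cases n)
  case 0
  then show ?thesis using assms continuous_on_cong[of U U f g] by simp
next
  case (Suc m)
  then obtain f' where f': "\<And>x. x\<in>U \<Longrightarrow> (f has_derivative f' x) (at x) \<and> Vector_Spaces.linear (*s) (*) (f' x)"
    "\<And>v. Ck_on m U (\<lambda>x. f' x v)"
    using assms(3) unfolding Suc Ck_on.simps by blast
  have "(g has_derivative f' x) (at x)" if "x \<in> U" for x
    using f' that assms has_derivative_transform_within_open by blast
  then show ?thesis using f' unfolding Suc Ck_on.simps by blast
qed

lemma smooth_on_has_derivative:
  assumes "smooth_on U f" "x \<in> U"
  shows "(f has_derivative frechet_derivative f (at x)) (at x)"
proof -
  have "Ck_on (Suc 0) U f" using assms(1) unfolding smooth_on_def by blast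
  then show ?thesis using assms(2)
    by (auto simp: frechet_derivative_works[symmetric] differentiable_def)
qed

text \<open>
  The derivatives that witness the different orders of differentiability agree on the open set, since the
  derivative is unique.
\<close>

lemma smooth_on_derivative:
  assumes "open U" "smooth_on U f"
  shows "smooth_on U (\<lambda>x. frechet_derivative f (at x) v)"
  unfolding smooth_on_def
proof
  fix n
  have "Ck_on (Suc n) U f" using assms(2) unfolding smooth_on_def by blast
  then obtain f' where f': "\<And>x. x\<in>U \<Longrightarrow> (f has_derivative f' x) (at x) \<and> Vector_Spaces.linear (*s) (*) (f' x)"
    "\<And>v. Ck_on n U (\<lambda>x. f' x v)"
    unfolding Ck_on.simps by blast
  show "Ck_on n U (\<lambda>x. frechet_derivative f (at x) v)"
    by (rule Ck_on_cong[OF assms(1) _ f'(2)[of v]]) (metis frechet_derivative_at f'(1))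
qed

lemma smooth_map_has_derivative:
  fixes \<phi> :: "'k::real_normed_field ^ 'd::finite \<Rightarrow> 'k ^ 'e::finite"
  assumes "smooth_map_on U \<phi>" "u \<in> U"
  shows "(\<phi> has_derivative frechet_derivative \<phi> (at u)) (at u)"
    and "frechet_derivative \<phi> (at u) w $ i = frechet_derivative (\<lambda>u. \<phi> u $ i) (at u) w"
proof -
  have "((\<lambda>u. \<phi> u $ i) has_derivative frechet_derivative (\<lambda>u. \<phi> u $ i) (at u)) (at u)" for i
    using assms smooth_on_has_derivative unfolding smooth_map_on_def by blast
  then have *: "(\<phi> has_derivative (\<lambda>w. \<chi> i. frechet_derivative (\<lambda>u. \<phi> u $ i) (at u) w)) (at u)"
    by (intro has_derivative_vecI) simp
  then show "(\<phi> has_derivative frechet_derivative \<phi> (at u)) (at u)"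
    using differentiableI frechet_derivative_works by blast
  show "frechet_derivative \<phi> (at u) w $ i = frechet_derivative (\<lambda>u. \<phi> u $ i) (at u) w"
    using frechet_derivative_at[OF *] by (metis vec_lambda_beta)
qed

lemma local_param_tangent:
  fixes \<phi> :: "'k::real_normed_field ^ 'd::finite \<Rightarrow> 'k ^ 'e::finite"
  assumes "local_param V U \<phi>" "u \<in> U"
  shows "\<phi> u \<in> V" "frechet_derivative \<phi> (at u) w \<in> tangent_space TYPE('d) V (\<phi> u)"
proof -
  show "\<phi> u \<in> V" using assms unfolding local_param_def by blast
  show "frechet_derivative \<phi> (at u) w \<in> tangent_space TYPE('d) V (\<phi> u)"
    using assms unfolding tangent_space_def by blast
qed

section \<open>Signs of permutations of a symplectic basis\<close>

text \<open>
  The entries of the standard symplectic matrix, for the pairing of \<open>2 i\<close> with \<open>2 i + 1\<close>.  In this form a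
  permutation that acts on the pairs and leaves parities alone visibly preserves it.
\<close>

definition symplectic_entry :: "nat \<Rightarrow> nat \<Rightarrow> int" where
  "symplectic_entry i j = (if i div 2 = j div 2 then int (j mod 2) - int (i mod 2) else 0)"

lemma swap_blocks_apply:
  "(Transposition.transpose (2 * i) (2 * j) \<circ> Transposition.transpose (2 * i + 1) (2 * j + 1)) x = 2 * Transposition.transpose i j (x div 2) + x mod 2"
  for i j x :: nat
proof -
  consider q where "x = 2 * q" | q where "x = 2 * q + 1"
    by (meson evenE oddE)
  then show ?thesis
  proof cases
    case 1
    then have "x \<noteq> 2 * i + 1" "x \<noteq> 2 * j + 1" by presburger+
    with 1 show ?thesis by (simp add: Transposition.transpose_def)
  next
    case 2
    have "2 * r + 1 \<noteq> 2 * s" for r s :: nat by presburger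
    then show ?thesis by (simp add: 2 Transposition.transpose_def)
  qed
qed

lemma symplectic_entry_swap_blocks:
  fixes i j :: nat
  defines "\<tau> \<equiv> Transposition.transpose (2 * i) (2 * j) \<circ> Transposition.transpose (2 * i + 1) (2 * j + 1)"
  shows "symplectic_entry (\<tau> x) (\<tau> y) = symplectic_entry x y"
proof -
  have "\<tau> z div 2 = Transposition.transpose i j (z div 2)" "\<tau> z mod 2 = z mod 2" for z
    unfolding \<tau>_def swap_blocks_apply by simp_all
  moreover have "Transposition.transpose i j a = Transposition.transpose i j b \<longleftrightarrow> a = b" for a b
    by (metis transpose_involutory)
  ultimately show ?thesis by (simp add: symplectic_entry_def)
qed

text \<open>
  A nonzero product means that \<open>\<rho>\<close> maps pairs to pairs; the product is then \<open>-1\<close> to the number of reversed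
  pairs, and this is also the sign of \<open>\<rho>\<close>.  The induction makes \<open>\<rho>\<close> fix the last pair: exchanging two whole
  pairs is an even permutation that leaves the product alone, and reversing the last pair changes the sign
  of both factors.
\<close>

lemma symplectic_permutation_product:
  assumes "\<rho> permutes {..<2 * M}"
    and "(\<Prod>i<M. symplectic_entry (\<rho> (2 * i)) (\<rho> (2 * i + 1))) \<noteq> 0"
  shows "sign \<rho> * (\<Prod>i<M. symplectic_entry (\<rho> (2 * i)) (\<rho> (2 * i + 1))) = 1"
  using assms
proof (induction M arbitrary: \<rho>)
  case 0
  then show ?case by simp
next
  case (Suc M)
  let ?P = "\<lambda>\<rho> M. \<Prod>i<M. symplectic_entry (\<rho> (2 * i)) (\<rho> (2 * i + 1))"
  let ?S = "{..<2 * Suc M}"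
  have fixed: "sign \<rho> * ?P \<rho> (Suc M) = 1"
    if \<rho>: "\<rho> permutes ?S" and nz: "?P \<rho> (Suc M) \<noteq> 0" and a: "\<rho> (2 * M) = 2 * M" and b: "\<rho> (2 * M + 1) = 2 * M + 1" for \<rho>
  proof -
    have "\<rho> permutes {..<2 * M}"
    proof (rule permutes_superset[OF \<rho>])
      fix x assume "x \<in> ?S - {..<2 * M}"
      then have "x = 2 * M \<or> x = 2 * M + 1" by auto
      then show "\<rho> x = x" using a b by auto
    qed
    moreover have P: "?P \<rho> (Suc M) = ?P \<rho> M"
      using a b by (simp add: symplectic_entry_def)
    ultimately show ?thesis using Suc.IH[of \<rho>] nz unfolding P by blast
  qed
  have swapped: "sign \<rho> * ?P \<rho> (Suc M) = 1"
    if \<rho>: "\<rho> permutes ?S" and nz: "?P \<rho> (Suc M) \<noteq> 0" and a: "\<rho> (2 * M) = 2 * M + 1" and b: "\<rho> (2 * M + 1) = 2 * M" for \<rho>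
  proof -
    let ?t = "Transposition.transpose (2 * M) (2 * M + 1)"
    have t: "?t permutes ?S" by (rule permutes_swap_id) auto
    have "?P (?t \<circ> \<rho>) M = ?P \<rho> M"
    proof (rule prod.cong[OF refl])
      fix i assume i: "i \<in> {..<M}"
      have "?t (\<rho> x) = \<rho> x" if "x \<noteq> 2 * M" "x \<noteq> 2 * M + 1" for x
        using permutes_inj[OF \<rho>, THEN injD, of x] a b that by (metis transpose_apply_other)
      then show "symplectic_entry ((?t \<circ> \<rho>) (2 * i)) ((?t \<circ> \<rho>) (2 * i + 1)) = symplectic_entry (\<rho> (2 * i)) (\<rho> (2 * i + 1))"
        using i by simp
    qed
    then have P: "?P (?t \<circ> \<rho>) (Suc M) = - ?P \<rho> (Suc M)"
      using a b by (simp add: symplectic_entry_def)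
    have "sign (?t \<circ> \<rho>) = - sign \<rho>"
      using sign_compose[of ?t \<rho>] permutes_imp_permutation[OF _ \<rho>] permutes_imp_permutation[OF _ t]
      by (simp add: sign_swap_id)
    moreover have "sign (?t \<circ> \<rho>) * ?P (?t \<circ> \<rho>) (Suc M) = 1"
      by (rule fixed[OF permutes_compose[OF \<rho> t]]) (use nz P a b in auto)
    ultimately show ?thesis using P by simp
  qed
  define j where "j = \<rho> (2 * M) div 2"
  \<comment> \<open>Exchange the image of the last pair with the last pair.\<close>
  define \<tau> where "\<tau> = Transposition.transpose (2 * j) (2 * M) \<circ> Transposition.transpose (2 * j + 1) (2 * M + 1)"
  have lt: "\<rho> (2 * M) < 2 * Suc M" using permutes_in_image[OF Suc.prems(1), of "2 * M"] by simp
  then have j: "j \<le> M" by (simp add: j_def)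
  have \<tau>: "\<tau> permutes ?S" unfolding \<tau>_def
    using j by (intro permutes_compose permutes_swap_id) auto
  have "sign \<tau> = 1"
    unfolding \<tau>_def by (subst sign_compose) (auto simp: sign_swap_id permutation_swap_id)
  then have sgn: "sign (\<tau> \<circ> \<rho>) = sign \<rho>"
    using sign_compose[of \<tau> \<rho>] permutes_imp_permutation[OF _ Suc.prems(1)] permutes_imp_permutation[OF _ \<tau>]
    by simp
  have P: "?P (\<tau> \<circ> \<rho>) (Suc M) = ?P \<rho> (Suc M)"
  proof -
    have "symplectic_entry (\<tau> y) (\<tau> z) = symplectic_entry y z" for y z
      unfolding \<tau>_def by (rule symplectic_entry_swap_blocks)
    then show ?thesis by (simp only: o_apply)
  qed
  have nz: "symplectic_entry (\<rho> (2 * M)) (\<rho> (2 * M + 1)) \<noteq> 0" using Suc.prems(2) by simp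
  have \<tau>\<rho>: "(\<tau> \<circ> \<rho>) permutes ?S" by (rule permutes_compose[OF Suc.prems(1) \<tau>])
  have a: "\<tau> (\<rho> (2 * M)) = 2 * M + \<rho> (2 * M) mod 2"
    unfolding \<tau>_def swap_blocks_apply by (simp add: j_def)
  have b: "\<tau> (\<rho> (2 * M + 1)) = 2 * M + \<rho> (2 * M + 1) mod 2"
    unfolding \<tau>_def swap_blocks_apply using nz by (simp add: j_def symplectic_entry_def split: if_splits)
  have "\<rho> (2 * M) mod 2 \<noteq> \<rho> (2 * M + 1) mod 2"
    using nz by (auto simp: symplectic_entry_def split: if_splits)
  then consider "\<rho> (2 * M) mod 2 = 0" "\<rho> (2 * M + 1) mod 2 = 1" | "\<rho> (2 * M) mod 2 = 1" "\<rho> (2 * M + 1) mod 2 = 0"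
    by fastforce
  then have "sign (\<tau> \<circ> \<rho>) * ?P (\<tau> \<circ> \<rho>) (Suc M) = 1"
  proof cases
    case 1
    then show ?thesis using a b P Suc.prems(2) by (intro fixed \<tau>\<rho>) auto
  next
    case 2
    then show ?thesis using a b P Suc.prems(2) by (intro swapped \<tau>\<rho>) auto
  qed
  then show ?case using sgn P by simp
qed

lemma shift_permutation:
  fixes k l :: nat
  assumes "\<tau> permutes {..<l}"
  obtains \<tau>' where "\<tau>' permutes {..<k + l}" "sign \<tau>' = sign \<tau>"
    "\<And>i. i < k \<Longrightarrow> \<tau>' i = i" "\<And>i. i < l \<Longrightarrow> \<tau>' (k + i) = k + \<tau> i"
proof
  let ?\<tau> = "map_permutation {..<l} ((+) k) \<tau>"
  have bij: "bij_betw ((+) k) {..<l} {k..<k + l}"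
    by (rule bij_betwI[of _ _ _ "\<lambda>i. i - k"]) auto
  have perm: "?\<tau> permutes {k..<k + l}"
    by (rule map_permutation_permutes[OF bij assms])
  then show "?\<tau> permutes {..<k + l}"
    by (rule permutes_subset) auto
  show "?\<tau> i = i" if "i < k" for i
    using permutes_not_in[OF perm] that by auto
  show "?\<tau> (k + i) = k + \<tau> i" if "i < l" for i
    using map_permutation_apply[of "(+) k" "{..<l}" i \<tau>] that by auto
  show "sign ?\<tau> = sign \<tau>"
    using bij assms by (auto intro!: sign_map_permutation simp: bij_betw_def)
qed

section \<open>Wedge products and wedge powers\<close>

text \<open>
  If \<open>\<beta>\<close> is already an antisymmetrization of \<open>\<gamma>\<close>, the permutations \<open>\<tau>\<close> of its own arguments can be absorbed
  into the permutations \<open>\<sigma>\<close> of the wedge product by the substitution \<open>\<sigma> \<mapsto> \<sigma> \<circ> \<tau>\<close>.  All \<open>fact l\<close> of them give the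
  same contribution, which cancels the normalizing factor.
\<close>

lemma wedge_antisymmetrized:
  fixes \<alpha> \<beta> :: "('k::real_normed_field, 'd::finite) dform"
  assumes dep: "\<And>v w. (\<And>i. i < k \<Longrightarrow> v i = w i) \<Longrightarrow> \<alpha> x v = \<alpha> x w"
    and \<beta>: "\<And>\<sigma>. \<beta> x (\<lambda>i. v (\<sigma> (k + i))) =
      c * (\<Sum>\<tau> | \<tau> permutes {..<l}. of_int (sign \<tau>) * \<gamma> (\<lambda>i. v (\<sigma> (k + \<tau> i))))"
    and \<gamma>: "\<And>v w. (\<And>i. i < l \<Longrightarrow> v i = w i) \<Longrightarrow> \<gamma> v = \<gamma> w"
  shows "wedge k l \<alpha> \<beta> x v = c / fact k *
    (\<Sum>\<sigma> | \<sigma> permutes {..<k + l}. of_int (sign \<sigma>) * \<alpha> x (\<lambda>i. v (\<sigma> i)) * \<gamma> (\<lambda>i. v (\<sigma> (k + i))))"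
proof -
  define F where "F \<sigma> = of_int (sign \<sigma>) * \<alpha> x (\<lambda>i. v (\<sigma> i)) * \<gamma> (\<lambda>i. v (\<sigma> (k + i)))" for \<sigma>
  let ?S = "{\<sigma>. \<sigma> permutes {..<k + l}}" and ?T = "{\<tau>. \<tau> permutes {..<l}}"
  have inner: "(\<Sum>\<sigma>\<in>?S. of_int (sign \<sigma>) * of_int (sign \<tau>) * \<alpha> x (\<lambda>i. v (\<sigma> i)) * \<gamma> (\<lambda>i. v (\<sigma> (k + \<tau> i))))
    = sum F ?S" if "\<tau> \<in> ?T" for \<tau>
  proof -
    obtain \<tau>' where \<tau>': "\<tau>' permutes {..<k + l}" "sign \<tau>' = sign \<tau>"
      "\<And>i. i < k \<Longrightarrow> \<tau>' i = i" "\<And>i. i < l \<Longrightarrow> \<tau>' (k + i) = k + \<tau> i"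
      using shift_permutation[of \<tau> l k] \<open>\<tau> \<in> ?T\<close> by auto
    have "sum F ?S = (\<Sum>\<sigma>\<in>?S. F (\<sigma> \<circ> \<tau>'))"
      by (rule sum_permutations_compose_right[OF \<tau>'(1)])
    also have "\<dots> = (\<Sum>\<sigma>\<in>?S. of_int (sign \<sigma>) * of_int (sign \<tau>) * \<alpha> x (\<lambda>i. v (\<sigma> i)) * \<gamma> (\<lambda>i. v (\<sigma> (k + \<tau> i))))"
    proof (rule sum.cong[OF refl])
      fix \<sigma> assume "\<sigma> \<in> ?S"
      then have "sign (\<sigma> \<circ> \<tau>') = sign \<sigma> * sign \<tau>"
        using \<tau>'(1,2) sign_compose[of \<sigma> \<tau>'] permutes_imp_permutation[of "{..<k + l}"] by simp
      moreover have "\<alpha> x (\<lambda>i. v (\<sigma> (\<tau>' i))) = \<alpha> x (\<lambda>i. v (\<sigma> i))"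
        by (rule dep) (simp add: \<tau>'(3))
      moreover have "\<gamma> (\<lambda>i. v (\<sigma> (\<tau>' (k + i)))) = \<gamma> (\<lambda>i. v (\<sigma> (k + \<tau> i)))"
        by (rule \<gamma>) (simp add: \<tau>'(4))
      ultimately show "F (\<sigma> \<circ> \<tau>') = of_int (sign \<sigma>) * of_int (sign \<tau>) * \<alpha> x (\<lambda>i. v (\<sigma> i)) * \<gamma> (\<lambda>i. v (\<sigma> (k + \<tau> i)))"
        by (simp add: F_def)
    qed
    finally show ?thesis by simp
  qed
  have "(\<Sum>\<sigma>\<in>?S. of_int (sign \<sigma>) * \<alpha> x (\<lambda>i. v (\<sigma> i)) * \<beta> x (\<lambda>i. v (\<sigma> (k + i))))
    = (\<Sum>\<sigma>\<in>?S. \<Sum>\<tau>\<in>?T. c * (of_int (sign \<sigma>) * of_int (sign \<tau>) * \<alpha> x (\<lambda>i. v (\<sigma> i)) * \<gamma> (\<lambda>i. v (\<sigma> (k + \<tau> i)))))"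
    unfolding \<beta> by (simp add: sum_distrib_left mult_ac)
  also have "\<dots> = (\<Sum>\<tau>\<in>?T. \<Sum>\<sigma>\<in>?S. c * (of_int (sign \<sigma>) * of_int (sign \<tau>) * \<alpha> x (\<lambda>i. v (\<sigma> i)) * \<gamma> (\<lambda>i. v (\<sigma> (k + \<tau> i)))))"
    by (rule sum.swap)
  also have "\<dots> = (\<Sum>\<tau>\<in>?T. c * sum F ?S)"
    by (rule sum.cong[OF refl]) (simp add: inner flip: sum_distrib_left)
  also have "\<dots> = fact l * c * sum F ?S"
    using card_permutations[of "{..<l}" l] by simp
  finally show ?thesis
    unfolding wedge_def F_def[symmetric] by (simp add: field_simps)
qed

lemma wedge_pow_2_unfold:
  fixes \<beta> :: "('k::real_normed_field, 'd::finite) dform"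
  assumes \<beta>: "\<And>v. (\<And>i. v i \<in> T) \<Longrightarrow> \<beta> x v = b (v 0) (v 1)"
    and dep: "\<And>v w. v 0 = w 0 \<Longrightarrow> v 1 = w 1 \<Longrightarrow> \<beta> x v = \<beta> x w"
  shows "(\<And>i. v i \<in> T) \<Longrightarrow> wedge_pow 2 \<beta> m x v =
    1 / 2 ^ m * (\<Sum>\<sigma> | \<sigma> permutes {..<2 * m}. of_int (sign \<sigma>) * (\<Prod>i<m. b (v (\<sigma> (2 * i))) (v (\<sigma> (2 * i + 1)))))"
proof (induction m arbitrary: v)
  case 0
  then show ?case by simp
next
  case (Suc m)
  let ?\<gamma> = "\<lambda>v. \<Prod>i<m. b (v (2 * i)) (v (2 * i + 1))"
  have "wedge 2 (2 * m) \<beta> (wedge_pow 2 \<beta> m) x v = 1 / 2 ^ m / fact 2 *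
    (\<Sum>\<sigma> | \<sigma> permutes {..<2 + 2 * m}. of_int (sign \<sigma>) * \<beta> x (\<lambda>i. v (\<sigma> i)) * ?\<gamma> (\<lambda>i. v (\<sigma> (2 + i))))"
  proof (rule wedge_antisymmetrized)
    show "\<beta> x v = \<beta> x w" if "\<And>i. i < 2 \<Longrightarrow> v i = w i" for v w
      by (rule dep) (simp_all add: that)
    show "wedge_pow 2 \<beta> m x (\<lambda>i. v (\<sigma> (2 + i))) = 1 / 2 ^ m *
      (\<Sum>\<tau> | \<tau> permutes {..<2 * m}. of_int (sign \<tau>) * ?\<gamma> (\<lambda>i. v (\<sigma> (2 + \<tau> i))))" for \<sigma>
      by (rule Suc.IH) (rule Suc.prems)
    show "?\<gamma> v = ?\<gamma> w" if "\<And>i. i < 2 * m \<Longrightarrow> v i = w i" for v w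
      by (rule prod.cong[OF refl]) (simp add: that)
  qed
  also have "\<dots> = 1 / 2 ^ Suc m * (\<Sum>\<sigma> | \<sigma> permutes {..<2 * Suc m}. of_int (sign \<sigma>) * (\<Prod>i<Suc m. b (v (\<sigma> (2 * i))) (v (\<sigma> (2 * i + 1)))))"
    unfolding prod.lessThan_Suc_shift by (simp add: \<beta> Suc.prems mult.assoc)
  finally show ?case by simp
qed

text \<open>
  The vectors \<open>b\<^sub>1, b\<^sub>2, \<dots>\<close> on which the form is evaluated are completed by \<open>b\<^sub>0\<close>, for which \<open>\<alpha> = B(b\<^sub>0, \<cdot>)\<close>.  The
  factor coming from \<open>\<alpha>\<close> is thereby one more entry of the symplectic matrix, and each summand is a product as in
  \<open>symplectic_permutation_product\<close>, for a permutation that fixes \<open>0\<close>.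
\<close>

lemma contact_product_on_symplectic_basis:
  fixes \<alpha> \<beta> :: "('k::real_normed_field, 'd::finite) dform"
  assumes \<beta>: "\<And>v. (\<And>i. v i \<in> T) \<Longrightarrow> \<beta> x v = 2 * B (v 0) (v 1)"
    and dep: "\<And>v w. v 0 = w 0 \<Longrightarrow> v 1 = w 1 \<Longrightarrow> \<beta> x v = \<beta> x w"
    and \<alpha>: "\<And>v. (\<And>i. v i \<in> T) \<Longrightarrow> \<alpha> x v = B (b 0) (v 0)"
    and dep1: "\<And>v w. v 0 = w 0 \<Longrightarrow> \<alpha> x v = \<alpha> x w"
    and T: "\<And>i. b (Suc i) \<in> T"
    and B: "\<And>i j. i < 2 * Suc m \<Longrightarrow> j < 2 * Suc m \<Longrightarrow> B (b i) (b j) = of_int (symplectic_entry i j)"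
  shows "wedge 1 (2 * m) \<alpha> (wedge_pow 2 \<beta> m) x (\<lambda>i. b (Suc i)) \<noteq> 0"
proof -
  let ?v = "\<lambda>i. b (Suc i)"
  let ?\<gamma> = "\<lambda>v. \<Prod>i<m. 2 * B (v (2 * i)) (v (2 * i + 1))"
  let ?S = "{\<sigma>. \<sigma> permutes {..<1 + 2 * m}}"
  let ?t = "\<lambda>\<sigma>. sign \<sigma> * symplectic_entry 0 (Suc (\<sigma> 0)) * (\<Prod>i<m. symplectic_entry (Suc (\<sigma> (1 + 2 * i))) (Suc (\<sigma> (1 + (2 * i + 1)))))"
  have "wedge 1 (2 * m) \<alpha> (wedge_pow 2 \<beta> m) x ?v = 1 / 2 ^ m / fact 1 *
    (\<Sum>\<sigma>\<in>?S. of_int (sign \<sigma>) * \<alpha> x (\<lambda>i. ?v (\<sigma> i)) * ?\<gamma> (\<lambda>i. ?v (\<sigma> (1 + i))))"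
  proof (rule wedge_antisymmetrized)
    show "\<alpha> x v = \<alpha> x w" if "\<And>i. i < 1 \<Longrightarrow> v i = w i" for v w
      by (rule dep1) (simp add: that)
    show "wedge_pow 2 \<beta> m x (\<lambda>i. ?v (\<sigma> (1 + i))) = 1 / 2 ^ m *
      (\<Sum>\<tau> | \<tau> permutes {..<2 * m}. of_int (sign \<tau>) * ?\<gamma> (\<lambda>i. ?v (\<sigma> (1 + \<tau> i))))" for \<sigma>
      by (rule wedge_pow_2_unfold[where T = T and b = "\<lambda>u w. 2 * B u w" and \<beta> = \<beta>])
        (rule \<beta> dep T; assumption)+
    show "?\<gamma> v = ?\<gamma> w" if "\<And>i. i < 2 * m \<Longrightarrow> v i = w i" for v w
      by (rule prod.cong[OF refl]) (simp add: that)
  qed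
  also have "(\<Sum>\<sigma>\<in>?S. of_int (sign \<sigma>) * \<alpha> x (\<lambda>i. ?v (\<sigma> i)) * ?\<gamma> (\<lambda>i. ?v (\<sigma> (1 + i))))
    = (\<Sum>\<sigma>\<in>?S. 2 ^ m * of_int (?t \<sigma>))"
  proof (rule sum.cong[OF refl])
    fix \<sigma> assume "\<sigma> \<in> ?S"
    then have lt: "Suc (\<sigma> i) < 2 * Suc m" if "i < 1 + 2 * m" for i
      using permutes_in_image[of \<sigma> "{..<1 + 2 * m}" i] that by simp
    have "\<alpha> x (\<lambda>i. ?v (\<sigma> i)) = of_int (symplectic_entry 0 (Suc (\<sigma> 0)))"
      using \<alpha>[of "\<lambda>i. ?v (\<sigma> i)"] T B[of 0 "Suc (\<sigma> 0)"] lt[of 0] by simp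
    moreover have "?\<gamma> (\<lambda>i. ?v (\<sigma> (1 + i))) = (\<Prod>i<m. 2 * of_int (symplectic_entry (Suc (\<sigma> (1 + 2 * i))) (Suc (\<sigma> (1 + (2 * i + 1))))))"
    proof (rule prod.cong[OF refl])
      fix i assume "i \<in> {..<m}"
      then show "2 * B (?v (\<sigma> (1 + 2 * i))) (?v (\<sigma> (1 + (2 * i + 1)))) = 2 * of_int (symplectic_entry (Suc (\<sigma> (1 + 2 * i))) (Suc (\<sigma> (1 + (2 * i + 1)))))"
        using B[OF lt lt, of "1 + 2 * i" "1 + (2 * i + 1)"] by simp
    qed
    ultimately show "of_int (sign \<sigma>) * \<alpha> x (\<lambda>i. ?v (\<sigma> i)) * ?\<gamma> (\<lambda>i. ?v (\<sigma> (1 + i))) = 2 ^ m * of_int (?t \<sigma>)"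
      by (simp add: prod.distrib)
  qed
  also have "\<dots> = 2 ^ m * of_int (\<Sum>\<sigma>\<in>?S. ?t \<sigma>)"
    by (simp only: sum_distrib_left of_int_sum)
  finally have eq: "wedge 1 (2 * m) \<alpha> (wedge_pow 2 \<beta> m) x ?v = of_int (\<Sum>\<sigma>\<in>?S. ?t \<sigma>)"
    by simp
  \<comment> \<open>Prepending a fixed point turns the first factor into the factor of the pair of \<open>0\<close> and \<open>1\<close>.\<close>
  have pos: "0 \<le> ?t \<sigma>" if "\<sigma> \<in> ?S" for \<sigma>
  proof -
    obtain \<rho> where \<rho>: "\<rho> permutes {..<1 + (1 + 2 * m)}" "sign \<rho> = sign \<sigma>"
      "\<And>i. i < 1 \<Longrightarrow> \<rho> i = i" "\<And>i. i < 1 + 2 * m \<Longrightarrow> \<rho> (1 + i) = 1 + \<sigma> i"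
      using shift_permutation[of \<sigma> "1 + 2 * m" 1] \<open>\<sigma> \<in> ?S\<close> by auto
    have "(\<Prod>i<Suc m. symplectic_entry (\<rho> (2 * i)) (\<rho> (2 * i + 1))) =
      symplectic_entry 0 (Suc (\<sigma> 0)) * (\<Prod>i<m. symplectic_entry (Suc (\<sigma> (1 + 2 * i))) (Suc (\<sigma> (1 + (2 * i + 1)))))"
    proof -
      have "\<rho> (2 * Suc i) = Suc (\<sigma> (1 + 2 * i))" "\<rho> (2 * Suc i + 1) = Suc (\<sigma> (1 + (2 * i + 1)))" if "i < m" for i
        using \<rho>(4)[of "1 + 2 * i"] \<rho>(4)[of "1 + (2 * i + 1)"] that by simp_all
      moreover have "\<rho> 0 = 0" "\<rho> 1 = Suc (\<sigma> 0)"
        using \<rho>(3)[of 0] \<rho>(4)[of 0] by simp_all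
      ultimately show ?thesis
        unfolding prod.lessThan_Suc_shift by simp
    qed
    moreover have "\<rho> permutes {..<2 * Suc m}" using \<rho>(1) by simp
    ultimately have "?t \<sigma> = 0 \<or> ?t \<sigma> = 1"
      using symplectic_permutation_product[of \<rho> "Suc m"] \<rho>(2) by (auto simp: mult.assoc)
    then show ?thesis by linarith
  qed
  have "1 = ?t id" by (simp add: symplectic_entry_def)
  also have "?t id \<le> (\<Sum>\<sigma>\<in>?S. ?t \<sigma>)"
  proof (rule member_le_sum)
    show "0 \<le> ?t \<sigma>" if "\<sigma> \<in> ?S - {id}" for \<sigma>
      using pos that by blast
  qed (use permutes_id in blast, simp add: finite_permutations)
  finally show ?thesis unfolding eq of_int_eq_0_iff by (rule contrapos_pn) simp
qed

section \<open>Symplectic bases\<close>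

locale alternating_form =
  fixes B :: "'k::field ^ 'd::finite \<Rightarrow> 'k ^ 'd \<Rightarrow> 'k"
  assumes add_left: "B (u + v) w = B u w + B v w"
    and scale_left: "B (c *s u) w = c * B u w"
    and skew: "B u v = - B v u"
    and self: "B u u = 0"
begin

lemma diff_left: "B (u - v) w = B u w - B v w"
proof -
  have "u - v = u + (-1) *s v" by (simp add: vec_eq_iff)
  then show ?thesis using add_left[of u "(-1) *s v" w] scale_left[of "-1" v w] by simp
qed

lemma add_right: "B w (u + v) = B w u + B w v"
  using add_left[of u v w] skew[of w "u + v"] skew[of w u] skew[of w v] by simp

lemma diff_right: "B w (u - v) = B w u - B w v"
  using diff_left[of u v w] skew[of w "u - v"] skew[of w u] skew[of w v] by simp

lemma scale_right: "B w (c *s u) = c * B w u"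
  using scale_left[of c u w] skew[of w "c *s u"] skew[of w u] by simp

lemma sum_left: "B (sum f I) w = (\<Sum>i\<in>I. B (f i) w)"
proof -
  have "B 0 w = 0" using scale_left[of 0 0 w] by simp
  then show ?thesis by (induction I rule: infinite_finite_induct) (simp_all add: add_left)
qed

definition symplectic_tuple :: "nat \<Rightarrow> (nat \<Rightarrow> 'k ^ 'd) \<Rightarrow> bool" where
  "symplectic_tuple n b \<longleftrightarrow> (\<forall>i<n. \<forall>j<n. B (b i) (b j) = of_int (symplectic_entry i j))"

text \<open>
  The vector \<open>z\<close> is the \<open>B\<close>-orthogonal projection of \<open>u\<close> to the span of the tuple; subtracting it makes \<open>u\<close>
  orthogonal to the tuple.
\<close>

lemma symplectic_projection:
  assumes "symplectic_tuple (2 * k) b"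
  obtains z where "z \<in> vec.span (b ` {..<2 * k})" "\<And>i. i < 2 * k \<Longrightarrow> B z (b i) = B u (b i)"
    "\<And>y. (\<And>i. i < 2 * k \<Longrightarrow> B y (b i) = 0) \<Longrightarrow> B y z = 0"
proof
  \<comment> \<open>The coefficient of a basis vector is, up to sign, the value of \<open>B\<close> on \<open>u\<close> and its partner.\<close>
  define z where "z = (\<Sum>i<k. B u (b (2 * i + 1)) *s b (2 * i) - B u (b (2 * i)) *s b (2 * i + 1))"
  show "z \<in> vec.span (b ` {..<2 * k})"
    unfolding z_def by (intro vec.span_sum vec.span_diff vec.span_scale vec.span_base) auto
  show "B z (b q) = B u (b q)" if q: "q < 2 * k" for q
  proof -
    have "B z (b q) = (\<Sum>i<k. if i = q div 2 then B u (b q) else 0)"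
      unfolding z_def sum_left
    proof (rule sum.cong[OF refl])
      fix i assume "i \<in> {..<k}"
      then have B: "B (b (2 * i)) (b q) = of_int (symplectic_entry (2 * i) q)"
        "B (b (2 * i + 1)) (b q) = of_int (symplectic_entry (2 * i + 1) q)"
        using assms q by (auto simp: symplectic_tuple_def)
      consider "i \<noteq> q div 2" | "q = 2 * i" | "q = 2 * i + 1" by linarith
      then show "B (B u (b (2 * i + 1)) *s b (2 * i) - B u (b (2 * i)) *s b (2 * i + 1)) (b q) =
        (if i = q div 2 then B u (b q) else 0)"
        unfolding diff_left scale_left B by cases (auto simp: symplectic_entry_def)
    qed
    also have "\<dots> = B u (b q)" using q by simp
    finally show ?thesis .
  qed
  show "B y z = 0" if y: "\<And>i. i < 2 * k \<Longrightarrow> B y (b i) = 0" for y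
  proof -
    have "B (b i) y = 0" if "i < 2 * k" for i using y[OF that] skew[of "b i" y] by simp
    then have "B z y = 0"
      unfolding z_def sum_left diff_left scale_left by (intro sum.neutral) auto
    then show ?thesis using skew[of y z] by simp
  qed
qed

text \<open>
  The symplectic analogue of a Gram-Schmidt step: a vector outside the span, made orthogonal to the tuple, is not
  zero, and by nondegeneracy it has a partner, which can be made orthogonal to the tuple as well.
\<close>

lemma symplectic_tuple_extend:
  assumes nondeg: "\<And>u. u \<noteq> 0 \<Longrightarrow> \<exists>w. B u w \<noteq> 0"
    and b: "symplectic_tuple (2 * k) b" and k: "2 * k < CARD('d)"
  obtains u w where "symplectic_tuple (2 * Suc k) (b(2 * k := u, 2 * k + 1 := w))"
proof -
  let ?S = "vec.span (b ` {..<2 * k})"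
  have "?S \<noteq> UNIV"
  proof
    assume "?S = UNIV"
    then have "vec.dim (UNIV :: ('k ^ 'd) set) \<le> card (b ` {..<2 * k})"
      by (intro vec.dim_le_card) auto
    also have "\<dots> \<le> 2 * k" using card_image_le[of "{..<2 * k}" b] by simp
    finally show False using k unfolding vec_dim_card by simp
  qed
  then obtain u0 where u0: "u0 \<notin> ?S" by blast
  obtain z where z: "z \<in> ?S" "\<And>i. i < 2 * k \<Longrightarrow> B z (b i) = B u0 (b i)"
    using symplectic_projection[OF b] by metis
  define u where "u = u0 - z"
  have ub: "B u (b i) = 0" if "i < 2 * k" for i using z(2)[OF that] by (simp add: u_def diff_left)
  have "u \<noteq> 0" using u0 z(1) by (auto simp: u_def)
  then obtain w0 where w0: "B u w0 \<noteq> 0" using nondeg by blast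
  obtain y where y: "\<And>i. i < 2 * k \<Longrightarrow> B y (b i) = B w0 (b i)" "B u y = 0"
    using symplectic_projection[OF b, of w0] ub by metis
  define w where "w = inverse (B u w0) *s (w0 - y)"
  have uw: "B u w = 1" using w0 by (simp add: w_def scale_right diff_right y(2))
  have wb: "B w (b i) = 0" if "i < 2 * k" for i
    using y(1)[OF that] by (simp add: w_def scale_left diff_left)
  have flip: "B w u = -1" "\<And>i. i < 2 * k \<Longrightarrow> B (b i) u = 0" "\<And>i. i < 2 * k \<Longrightarrow> B (b i) w = 0"
    using uw skew[of w u] ub skew[of "b _" u] wb skew[of "b _" w] by simp_all
  have "symplectic_tuple (2 * Suc k) (b(2 * k := u, 2 * k + 1 := w))"
    unfolding symplectic_tuple_def
  proof (intro allI impI)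
    fix i j :: nat assume "i < 2 * Suc k" "j < 2 * Suc k"
    then have ij: "i < 2 * k \<or> i = 2 * k \<or> i = 2 * k + 1" "j < 2 * k \<or> j = 2 * k \<or> j = 2 * k + 1"
      by auto
    have "i div 2 \<noteq> k" if "i < 2 * k" for i :: nat using that by auto
    then show "B ((b(2 * k := u, 2 * k + 1 := w)) i) ((b(2 * k := u, 2 * k + 1 := w)) j) = of_int (symplectic_entry i j)"
      using ij
    proof (elim disjE)
      assume "i < 2 * k" "j < 2 * k"
      then show ?thesis using b by (simp add: symplectic_tuple_def)
    qed (simp_all add: ub wb uw flip self symplectic_entry_def)
  qed
  then show thesis by (rule that)
qed

lemma symplectic_basis_exists:
  assumes nondeg: "\<And>u. u \<noteq> 0 \<Longrightarrow> \<exists>w. B u w \<noteq> 0"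
    and xy: "B x y = 1" and k: "2 * Suc k \<le> CARD('d)"
  shows "\<exists>b. symplectic_tuple (2 * Suc k) b \<and> b 0 = x \<and> b 1 = y"
  using k
proof (induction k)
  case 0
  have "symplectic_tuple 2 (\<lambda>i. if i = 0 then x else y)"
    using xy self skew[of y x] by (auto simp: symplectic_tuple_def symplectic_entry_def less_2_cases_iff)
  then show ?case by (auto intro!: exI[of _ "\<lambda>i. if i = 0 then x else y"] simp: numeral_2_eq_2)
next
  case (Suc k)
  then obtain b where b: "symplectic_tuple (2 * Suc k) b" "b 0 = x" "b 1 = y" by auto
  obtain u w where "symplectic_tuple (2 * Suc (Suc k)) (b(2 * Suc k := u, 2 * Suc k + 1 := w))"
    using symplectic_tuple_extend[OF nondeg b(1)] Suc.prems by auto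
  moreover have "(b(2 * Suc k := u, 2 * Suc k + 1 := w)) 0 = x" "(b(2 * Suc k := u, 2 * Suc k + 1 := w)) 1 = y"
    using b(2,3) by auto
  ultimately show ?case by blast
qed

end

section \<open>The bilinear form behind the Pfaffian form\<close>

text \<open>
  Reading the second argument as a tangent vector at the first one, this is the form \<^const>\<open>omega\<close>.
\<close>

definition row_form :: "nat \<Rightarrow> (nat \<Rightarrow> 'n) \<Rightarrow> 'k::field ^ ('n::finite \<times> 'n) \<Rightarrow> 'k ^ ('n \<times> 'n) \<Rightarrow> 'k" where
  "row_form p e a v = (\<Sum>i = 1..2 * p. \<Sum>j = 1..p.
     a $ (e i, e (2 * j)) * v $ (e i, e (2 * j - 1)) - a $ (e i, e (2 * j - 1)) * v $ (e i, e (2 * j)))"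

lemma omega_eq_row_form: "omega p e a v = row_form p e a (v 0)"
  by (simp add: omega_def row_form_def dcoord_apply)

interpretation row_form: alternating_form "row_form p e :: 'k::field ^ ('n::finite \<times> 'n) \<Rightarrow> _" for p e
proof
  fix u v w :: "'k ^ ('n \<times> 'n)" and c
  show "row_form p e (u + v) w = row_form p e u w + row_form p e v w"
    by (simp add: row_form_def sum.distrib[symmetric] algebra_simps)
  show "row_form p e (c *s u) w = c * row_form p e u w"
    by (simp add: row_form_def sum_distrib_left algebra_simps)
  show "row_form p e u v = - row_form p e v u"
    by (simp add: row_form_def sum_negf[symmetric] algebra_simps)
  show "row_form p e u u = 0"
    by (simp add: row_form_def mult.commute)
qed

lemma sum_odd_even: "(\<Sum>k = 1..2 * p. f k) = (\<Sum>j = 1..p. f (2 * j - 1) + f (2 * j))" for p :: nat and f :: "nat \<Rightarrow> 'a::comm_monoid_add"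
  by (induction p) (simp_all add: add_ac)

text \<open>
  Up to signs, \<open>n\<close> is obtained from the coefficients \<open>D\<close> by exchanging the columns \<open>2 j - 1\<close> and \<open>2 j\<close>.
\<close>

lemma row_form_represents:
  fixes D :: "'n::finite \<times> 'n \<Rightarrow> 'k::field"
  assumes e: "bij_betw e {1..2 * p} UNIV"
  obtains n where "\<And>v. row_form p e n v = (\<Sum>c\<in>UNIV. D c * v $ c)"
proof
  define e' where "e' = inv_into {1..2 * p} e"
  have e': "e' (e k) = k" if "k \<in> {1..2 * p}" for k
    using that e by (simp add: e'_def bij_betw_def)
  define n where "n = (\<chi> c. if even (e' (snd c)) then D (fst c, e (e' (snd c) - 1)) else - D (fst c, e (e' (snd c) + 1)))"
  show "row_form p e n v = (\<Sum>c\<in>UNIV. D c * v $ c)" for v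
  proof -
    have "row_form p e n v = (\<Sum>i = 1..2 * p. \<Sum>j = 1..p.
      D (e i, e (2 * j - 1)) * v $ (e i, e (2 * j - 1)) + D (e i, e (2 * j)) * v $ (e i, e (2 * j)))"
      unfolding row_form_def
    proof (intro sum.cong refl)
      fix i j assume j: "j \<in> {1..p}"
      have "e' (e (2 * j)) = 2 * j" "e' (e (2 * j - 1)) = 2 * j - 1" using j by (auto intro!: e')
      moreover have "odd (2 * j - 1)" "2 * j - 1 + 1 = 2 * j" using j by auto
      ultimately show "n $ (e i, e (2 * j)) * v $ (e i, e (2 * j - 1)) - n $ (e i, e (2 * j - 1)) * v $ (e i, e (2 * j)) =
        D (e i, e (2 * j - 1)) * v $ (e i, e (2 * j - 1)) + D (e i, e (2 * j)) * v $ (e i, e (2 * j))"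
        by (simp add: n_def)
    qed
    also have "\<dots> = (\<Sum>i = 1..2 * p. \<Sum>k = 1..2 * p. D (e i, e k) * v $ (e i, e k))"
      unfolding sum_odd_even[of _ p] ..
    also have "\<dots> = (\<Sum>i\<in>UNIV. \<Sum>k\<in>UNIV. D (i, k) * v $ (i, k))"
    proof -
      have "(\<Sum>k = 1..2 * p. D (i, e k) * v $ (i, e k)) = (\<Sum>k\<in>UNIV. D (i, k) * v $ (i, k))" for i
        by (rule sum.reindex_bij_betw[OF e])
      then show ?thesis
        using sum.reindex_bij_betw[OF e, of "\<lambda>i. \<Sum>k\<in>UNIV. D (i, k) * v $ (i, k)"] by simp
    qed
    also have "\<dots> = (\<Sum>c\<in>UNIV. D c * v $ c)"
      by (simp add: sum.cartesian_product UNIV_Times_UNIV case_prod_unfold)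
    finally show ?thesis .
  qed
qed

lemma row_form_nondegenerate:
  fixes u :: "'k::field ^ ('n::finite \<times> 'n)"
  assumes e: "bij_betw e {1..2 * p} UNIV" and "u \<noteq> 0"
  shows "\<exists>w. row_form p e u w \<noteq> 0"
proof -
  obtain c where c: "u $ c \<noteq> 0" using \<open>u \<noteq> 0\<close> by (auto simp: vec_eq_iff)
  obtain n :: "'k ^ ('n \<times> 'n)" where "\<And>v. row_form p e n v = (\<Sum>d\<in>UNIV. (if d = c then 1 else 0) * v $ d)"
    using row_form_represents[OF e] by metis
  then have "row_form p e n u = u $ c" by (simp add: if_distrib[of "\<lambda>x. x * _"] cong: if_cong)
  then show ?thesis using c row_form.skew[of p e u n] by (intro exI[of _ n]) simp
qed

lemma row_form_has_derivative:
  fixes f g :: "'a::real_normed_vector \<Rightarrow> 'k::real_normed_field ^ ('n::finite \<times> 'n)"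
  assumes f: "(f has_derivative f') (at x)" and g: "(g has_derivative g') (at x)"
  shows "((\<lambda>y. row_form p e (f y) (g y)) has_derivative
    (\<lambda>h. row_form p e (f x) (g' h) + row_form p e (f' h) (g x))) (at x)"
proof -
  note nth = bounded_linear.has_derivative[OF bounded_linear_vec_nth]
  have "((\<lambda>y. row_form p e (f y) (g y)) has_derivative (\<lambda>h. \<Sum>i = 1..2 * p. \<Sum>j = 1..p.
    (f x $ (e i, e (2 * j)) * g' h $ (e i, e (2 * j - 1)) + f' h $ (e i, e (2 * j)) * g x $ (e i, e (2 * j - 1))) -
    (f x $ (e i, e (2 * j - 1)) * g' h $ (e i, e (2 * j)) + f' h $ (e i, e (2 * j - 1)) * g x $ (e i, e (2 * j))))) (at x)"
    unfolding row_form_def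
    by (intro has_derivative_sum has_derivative_diff has_derivative_mult nth f g)
  then show ?thesis
    by (rule has_derivative_eq_rhs) (simp add: row_form_def fun_eq_iff sum.distrib[symmetric] algebra_simps)
qed

text \<open>
  Differentiating \<open>B(\<phi>, D\<phi> w)\<close> produces two kinds of terms.  Those with a second derivative of \<open>\<phi>\<close> cancel in
  the alternating sum by symmetry, and by skew symmetry the others add up to twice \<open>B\<close>.
\<close>

lemma ext_deriv_pullback_omega:
  fixes V :: "('k::real_normed_field ^ ('n::finite \<times> 'n)) set" and \<phi> :: "'k ^ 'd::finite \<Rightarrow> 'k ^ ('n \<times> 'n)"
  assumes \<phi>: "local_param V U \<phi>" and u: "u \<in> U"
  shows "ext_deriv 1 (pullback \<phi> (induced_form TYPE('d) 1 V (omega p e))) u w =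
    2 * row_form p e (frechet_derivative \<phi> (at u) (w 0)) (frechet_derivative \<phi> (at u) (w 1))"
proof -
  let ?\<alpha> = "pullback \<phi> (induced_form TYPE('d) 1 V (omega p e))"
  let ?D = "\<lambda>y. frechet_derivative \<phi> (at y)"
  have U: "open U" and sm: "smooth_map_on U \<phi>" using \<phi> by (auto simp: local_param_def)
  have D: "(\<phi> has_derivative ?D y) (at y)" if "y \<in> U" for y
    using smooth_map_has_derivative(1)[OF sm that] .
  have DD: "\<exists>A. ((\<lambda>y. ?D y v) has_derivative A) (at u)" for v
  proof -
    have "((\<lambda>y. ?D y v $ i) has_derivative frechet_derivative (\<lambda>y. frechet_derivative (\<lambda>y. \<phi> y $ i) (at y) v) (at u)) (at u)" for i
    proof (rule has_derivative_transform_within_open[OF _ U u])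
      show "((\<lambda>y. frechet_derivative (\<lambda>y. \<phi> y $ i) (at y) v) has_derivative
          frechet_derivative (\<lambda>y. frechet_derivative (\<lambda>y. \<phi> y $ i) (at y) v) (at u)) (at u)"
        using smooth_on_has_derivative[OF smooth_on_derivative[OF U] u] sm
        unfolding smooth_map_on_def by blast
    qed (simp add: smooth_map_has_derivative(2)[OF sm])
    then have "((\<lambda>y. ?D y v) has_derivative
      (\<lambda>h. \<chi> i. frechet_derivative (\<lambda>y. frechet_derivative (\<lambda>y. \<phi> y $ i) (at y) v) (at u) h)) (at u)"
      by (intro has_derivative_vecI) simp
    then show ?thesis by blast
  qed
  obtain A where A: "((\<lambda>y. ?D y (w 0)) has_derivative A) (at u)" using DD by blast
  obtain B where B: "((\<lambda>y. ?D y (w 1)) has_derivative B) (at u)" using DD by blast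
  have sym: "A (w 1) = B (w 0)"
    by (rule second_derivative_symmetric[OF U u D A B])
  have \<alpha>: "?\<alpha> y v = row_form p e (\<phi> y) (?D y (v 0))" if "y \<in> U" for y v
  proof -
    have "\<phi> y \<in> V" "?D y (v 0) \<in> tangent_space TYPE('d) V (\<phi> y)"
      using local_param_tangent[OF \<phi> that] by blast+
    then show ?thesis by (simp add: pullback_def induced_form_def omega_eq_row_form)
  qed
  have F: "frechet_derivative (\<lambda>y. ?\<alpha> y v) (at u) =
    (\<lambda>h. row_form p e (\<phi> u) (C h) + row_form p e (?D u h) (?D u (v 0)))"
    if C: "((\<lambda>y. ?D y (v 0)) has_derivative C) (at u)" for v C
  proof (rule frechet_derivative_at[symmetric])
    show "((\<lambda>y. ?\<alpha> y v) has_derivative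
      (\<lambda>h. row_form p e (\<phi> u) (C h) + row_form p e (?D u h) (?D u (v 0)))) (at u)"
      by (rule has_derivative_transform_within_open[OF row_form_has_derivative[OF D[OF u] C] U u]) (rule \<alpha>[symmetric])
  qed
  have "ext_deriv 1 ?\<alpha> u w = frechet_derivative (\<lambda>y. ?\<alpha> y (\<lambda>j. w (Suc j))) (at u) (w 0)
    - frechet_derivative (\<lambda>y. ?\<alpha> y (\<lambda>j. if j < 1 then w j else w (Suc j))) (at u) (w 1)"
    by (simp add: ext_deriv_def)
  also have "\<dots> = row_form p e (?D u (w 0)) (?D u (w 1)) - row_form p e (?D u (w 1)) (?D u (w 0))"
    using F[of "\<lambda>j. w (Suc j)" B] F[of "\<lambda>j. if j < 1 then w j else w (Suc j)" A] A B sym by simp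
  also have "\<dots> = 2 * row_form p e (?D u (w 0)) (?D u (w 1))"
    using row_form.skew[of p e "?D u (w 1)" "?D u (w 0)"] by simp
  finally show ?thesis .
qed

lemma ext_deriv_on_cong:
  assumes "\<And>i. i \<le> k \<Longrightarrow> v i = w i"
  shows "ext_deriv_on TYPE('d::finite) V k \<alpha> x v = ext_deriv_on TYPE('d) V k \<alpha> x w"
proof -
  have "(\<forall>i\<le>k. y i = v i) \<longleftrightarrow> (\<forall>i\<le>k. y i = w i)" for y using assms by auto
  then show ?thesis by (simp add: ext_deriv_on_def)
qed

section \<open>Charts and tangent spaces of the special linear group\<close>

definition entry_matrix :: "'k ^ ('n::finite \<times> 'n) \<Rightarrow> 'k ^ 'n ^ 'n" where
  "entry_matrix x = (\<chi> i j. x $ (i, j))"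

text \<open>
  The signed cofactor at the position \<open>c\<close>, as the sum of the terms of the Leibniz formula that contain the
  entry \<open>c\<close>, with that entry removed.
\<close>

definition cofactor :: "'k::field ^ ('n::finite \<times> 'n) \<Rightarrow> 'n \<times> 'n \<Rightarrow> 'k" where
  "cofactor x c = (\<Sum>\<pi> | \<pi> permutes UNIV \<and> \<pi> (fst c) = snd c.
     of_int (sign \<pi>) * (\<Prod>l\<in>UNIV - {fst c}. x $ (l, \<pi> l)))"

definition det_remainder :: "'k::field ^ ('n::finite \<times> 'n) \<Rightarrow> 'n \<times> 'n \<Rightarrow> 'k" where
  "det_remainder x c = (\<Sum>\<pi> | \<pi> permutes UNIV \<and> \<pi> (fst c) \<noteq> snd c.
     of_int (sign \<pi>) * (\<Prod>l\<in>UNIV. x $ (l, \<pi> l)))"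

lemma det_entry_matrix:
  "det (entry_matrix x) = (\<Sum>\<pi> | \<pi> permutes UNIV. of_int (sign \<pi>) * (\<Prod>l\<in>UNIV. x $ (l, \<pi> l)))"
  by (simp add: det_def entry_matrix_def)

lemma det_affine_in_entry:
  fixes x :: "'k::field ^ ('n::finite \<times> 'n)"
  shows "det (entry_matrix x) = x $ c * cofactor x c + det_remainder x c"
proof -
  let ?f = "\<lambda>\<pi>. of_int (sign \<pi>) * (\<Prod>l\<in>UNIV. x $ (l, \<pi> l)) :: 'k"
  have "sum ?f {\<pi>. \<pi> permutes UNIV} =
    sum ?f {\<pi>. \<pi> permutes UNIV \<and> \<pi> (fst c) = snd c} + sum ?f {\<pi>. \<pi> permutes UNIV \<and> \<pi> (fst c) \<noteq> snd c}"
    by (subst sum.union_disjoint[symmetric]) (auto intro!: sum.cong)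
  moreover have "sum ?f {\<pi>. \<pi> permutes UNIV \<and> \<pi> (fst c) = snd c} = x $ c * cofactor x c"
    unfolding cofactor_def sum_distrib_left
    by (rule sum.cong[OF refl]) (auto simp: prod.remove[of UNIV "fst c"])
  ultimately show ?thesis by (simp add: det_entry_matrix det_remainder_def)
qed

lemma cofactor_cong:
  assumes "\<And>k. k \<noteq> c \<Longrightarrow> x $ k = y $ k"
  shows "cofactor x c = cofactor y c"
  unfolding cofactor_def
proof (intro sum.cong refl arg_cong2[where f = "(*)"] prod.cong)
  fix \<pi> l assume "l \<in> UNIV - {fst c}"
  then show "x $ (l, \<pi> l) = y $ (l, \<pi> l)" by (intro assms) auto
qed

lemma det_remainder_cong:
  assumes "\<And>k. k \<noteq> c \<Longrightarrow> x $ k = y $ k"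
  shows "det_remainder x c = det_remainder y c"
  unfolding det_remainder_def
proof (intro sum.cong refl arg_cong2[where f = "(*)"] prod.cong)
  fix \<pi> l assume "\<pi> \<in> {\<pi>. \<pi> permutes UNIV \<and> \<pi> (fst c) \<noteq> snd c}"
  then show "x $ (l, \<pi> l) = y $ (l, \<pi> l)" by (intro assms) auto
qed

text \<open>
  The right hand side is what the product rule gives for the derivative of the Leibniz formula; the left hand side
  collects its terms by the entry that is differentiated.
\<close>

lemma sum_cofactors:
  fixes x v :: "'k::field ^ ('n::finite \<times> 'n)"
  shows "(\<Sum>c\<in>UNIV. cofactor x c * v $ c) =
    (\<Sum>\<pi> | \<pi> permutes UNIV. of_int (sign \<pi>) * (\<Sum>i\<in>UNIV. v $ (i, \<pi> i) * (\<Prod>l\<in>UNIV - {i}. x $ (l, \<pi> l))))"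
proof -
  let ?g = "\<lambda>\<pi> i. of_int (sign \<pi>) * (v $ (i, \<pi> i) * (\<Prod>l\<in>UNIV - {i}. x $ (l, \<pi> l)))"
  have "(\<Sum>j\<in>UNIV. cofactor x (i, j) * v $ (i, j)) = (\<Sum>\<pi> | \<pi> permutes UNIV. ?g \<pi> i)" for i
  proof -
    have "(\<Sum>j\<in>UNIV. cofactor x (i, j) * v $ (i, j)) =
      (\<Sum>j\<in>UNIV. \<Sum>\<pi> | \<pi> \<in> {\<pi>. \<pi> permutes UNIV} \<and> \<pi> i = j. ?g \<pi> i)"
      unfolding cofactor_def sum_distrib_right by (intro sum.cong) auto
    also have "\<dots> = (\<Sum>\<pi> | \<pi> permutes UNIV. ?g \<pi> i)"
      by (rule sum.group) auto
    finally show ?thesis .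
  qed
  then have "(\<Sum>i\<in>UNIV. \<Sum>j\<in>UNIV. cofactor x (i, j) * v $ (i, j)) = (\<Sum>\<pi> | \<pi> permutes UNIV. \<Sum>i\<in>UNIV. ?g \<pi> i)"
    by (simp add: sum.swap[of _ UNIV])
  then show ?thesis
    by (simp add: sum.cartesian_product UNIV_Times_UNIV case_prod_unfold sum_distrib_left)
qed

lemma det_has_derivative:
  fixes x :: "'k::real_normed_field ^ ('n::finite \<times> 'n)"
  shows "((\<lambda>x. det (entry_matrix x)) has_derivative (\<lambda>v. \<Sum>c\<in>UNIV. cofactor x c * v $ c)) (at x)"
  unfolding det_entry_matrix sum_cofactors
  by (intro has_derivative_sum has_derivative_mult_right has_derivative_prod bounded_linear_imp_has_derivative bounded_linear_vec_nth)

text \<open>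
  Euler's identity for the determinant, which is homogeneous of degree \<open>CARD('n)\<close>: by \<open>det_has_derivative\<close> the
  left hand side is the derivative of the determinant at \<open>x\<close> in the direction \<open>x\<close>.
\<close>

lemma cofactor_Euler:
  fixes x :: "'k::field ^ ('n::finite \<times> 'n)"
  shows "(\<Sum>c\<in>UNIV. cofactor x c * x $ c) = of_nat CARD('n) * det (entry_matrix x)"
proof -
  have "x $ (i, \<pi> i) * (\<Prod>l\<in>UNIV - {i}. x $ (l, \<pi> l)) = (\<Prod>l\<in>UNIV. x $ (l, \<pi> l))" for i \<pi>
    by (simp add: prod.remove[of UNIV i])
  then show ?thesis
    by (simp add: sum_cofactors det_entry_matrix sum_distrib_left mult.left_commute)
qed

lemma in_SL_iff: "x \<in> SL \<longleftrightarrow> det (entry_matrix x) = 1"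
  by (simp add: SL_def entry_matrix_def)

lemma Ck_on_cofactor:
  assumes "\<And>k. Ck_on n U (\<lambda>u. h u $ k)"
  shows "Ck_on n U (\<lambda>u. cofactor (h u) c)"
  unfolding cofactor_def by (intro Ck_on_sum Ck_on_mult Ck_on_const Ck_on_prod assms)

lemma Ck_on_det_remainder:
  assumes "\<And>k. Ck_on n U (\<lambda>u. h u $ k)"
  shows "Ck_on n U (\<lambda>u. det_remainder (h u) c)"
  unfolding det_remainder_def by (intro Ck_on_sum Ck_on_mult Ck_on_const Ck_on_prod assms)

definition fill_entry :: "'c \<Rightarrow> ('c \<Rightarrow> 'd) \<Rightarrow> 'k \<Rightarrow> 'k ^ 'd \<Rightarrow> 'k ^ 'c" where
  "fill_entry c g t u = (\<chi> k. if k = c then t else u $ g k)"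

text \<open>
  The entry \<open>c\<close> is the solution of \<open>det = 1\<close>, which is a linear equation for it; the value \<open>0\<close> serves as a
  placeholder there, since neither the cofactor nor the remainder depends on that entry.  The map \<open>g\<close> numbers
  the other entries.
\<close>

definition SL_chart :: "'n::finite \<times> 'n \<Rightarrow> ('n \<times> 'n \<Rightarrow> 'd::finite) \<Rightarrow> 'k::real_normed_field ^ 'd \<Rightarrow> 'k ^ ('n \<times> 'n)" where
  "SL_chart c g u = fill_entry c g
     ((1 - det_remainder (fill_entry c g 0 u) c) * inverse (cofactor (fill_entry c g 0 u) c)) u"

text \<open>
  The chart is a graph, so the projection to the other coordinates is its inverse; this gives the homeomorphism and
  the injectivity of the derivative.
\<close>

lemma SL_chart_local_param:
  fixes f :: "'d::finite \<Rightarrow> 'n::finite \<times> 'n" and c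
  defines "\<phi> \<equiv> SL_chart c (inv_into UNIV f) :: 'k::real_normed_field ^ 'd \<Rightarrow> 'k ^ ('n \<times> 'n)"
  assumes f: "bij_betw f UNIV (- {c})"
  obtains U where "local_param SL U \<phi>" "\<phi> ` U = SL \<inter> {x. cofactor x c \<noteq> 0}"
    and "\<And>u v k. u \<in> U \<Longrightarrow> frechet_derivative \<phi> (at u) v $ f k = v $ k"
proof -
  let ?g = "inv_into UNIV f"
  have gf: "?g (f i) = i" for i using f by (simp add: bij_betw_def)
  have fg: "f (?g k) = k" if "k \<noteq> c" for k using f that by (auto simp: bij_betw_def intro!: f_inv_into_f)
  have fc: "f i \<noteq> c" for i using f by (auto simp: bij_betw_def)
  define E where "E = (fill_entry c ?g 0 :: 'k ^ 'd \<Rightarrow> _)"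
  define U where "U = {u. cofactor (E u) c \<noteq> 0}"
  define \<psi> where "\<psi> x = (\<chi> i. x $ f i)" for x :: "'k ^ ('n \<times> 'n)"
  have \<phi>_nth: "\<phi> u $ k = (if k = c then (1 - det_remainder (E u) c) * inverse (cofactor (E u) c) else u $ ?g k)" for u k
    by (simp add: \<phi>_def SL_chart_def fill_entry_def E_def)
  have E_nth: "E u $ k = (if k = c then 0 else u $ ?g k)" for u k
    by (simp add: E_def fill_entry_def)
  have E_Ck: "Ck_on n S (\<lambda>u. E u $ k)" for n S k
    unfolding E_nth by (cases "k = c") (simp_all add: Ck_on_const Ck_on_nth)
  have contC: "continuous_on UNIV (\<lambda>x. cofactor (h x) c)"
    if "\<And>k. Ck_on 0 UNIV (\<lambda>x. h x $ k)" for h :: "'k ^ 'e::finite \<Rightarrow> 'k ^ ('n \<times> 'n)"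
    using Ck_on_cofactor[OF that] by simp
  have "open U"
  proof -
    have "open ((\<lambda>u. cofactor (E u) c) -` (- {0}))"
      by (intro continuous_open_vimage) (use contC[OF E_Ck] in \<open>auto simp: continuous_on_eq_continuous_at\<close>)
    then show ?thesis by (simp add: U_def vimage_def)
  qed
  have open_cof: "open {x :: 'k ^ ('n \<times> 'n). cofactor x c \<noteq> 0}"
  proof -
    have "open ((\<lambda>x :: 'k ^ ('n \<times> 'n). cofactor x c) -` (- {0}))"
      by (intro continuous_open_vimage) (use contC[OF Ck_on_nth] in \<open>auto simp: continuous_on_eq_continuous_at\<close>)
    then show ?thesis by (simp add: vimage_def)
  qed
  have smooth: "smooth_map_on U \<phi>"
    unfolding smooth_map_on_def smooth_on_def
  proof (intro allI)
    fix k n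
    have "Ck_on n U (\<lambda>u. (1 + (-1) * det_remainder (E u) c) * inverse (cofactor (E u) c))"
      by (intro Ck_on_mult Ck_on_add Ck_on_const Ck_on_inverse Ck_on_det_remainder Ck_on_cofactor E_Ck)
        (simp add: U_def)
    then show "Ck_on n U (\<lambda>u. \<phi> u $ k)"
      unfolding \<phi>_nth by (cases "k = c") (simp_all add: Ck_on_nth)
  qed
  have cof_\<phi>: "cofactor (\<phi> u) c = cofactor (E u) c" "det_remainder (\<phi> u) c = det_remainder (E u) c" for u
    by (rule cofactor_cong det_remainder_cong; simp add: \<phi>_nth E_nth)+
  have cof_E: "cofactor (E (\<psi> x)) c = cofactor x c" "det_remainder (E (\<psi> x)) c = det_remainder x c" for x
    by (rule cofactor_cong det_remainder_cong; simp add: E_nth \<psi>_def fg)+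
  have \<psi>\<phi>: "\<psi> (\<phi> u) = u" for u
    by (simp add: vec_eq_iff \<psi>_def \<phi>_nth fc gf)
  have \<phi>\<psi>: "\<phi> (\<psi> x) = x" if "x \<in> SL" "cofactor x c \<noteq> 0" for x
  proof -
    have "(1 - det_remainder x c) * inverse (cofactor x c) = x $ c"
      using det_affine_in_entry[of x c] that by (simp add: in_SL_iff field_simps)
    then show ?thesis by (simp add: vec_eq_iff \<phi>_nth cof_E) (simp add: \<psi>_def fg)
  qed
  have in_SL: "\<phi> u \<in> SL" if "u \<in> U" for u
    using that det_affine_in_entry[of "\<phi> u" c] by (simp add: in_SL_iff cof_\<phi> \<phi>_nth U_def mult.assoc)
  have image: "\<phi> ` U = SL \<inter> {x. cofactor x c \<noteq> 0}"
  proof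
    show "\<phi> ` U \<subseteq> SL \<inter> {x. cofactor x c \<noteq> 0}"
      using in_SL by (auto simp: cof_\<phi> U_def)
    show "SL \<inter> {x. cofactor x c \<noteq> 0} \<subseteq> \<phi> ` U"
    proof
      fix x :: "'k ^ ('n \<times> 'n)" assume "x \<in> SL \<inter> {x. cofactor x c \<noteq> 0}"
      then have "x = \<phi> (\<psi> x)" "\<psi> x \<in> U" using \<phi>\<psi> by (auto simp: U_def cof_E)
      then show "x \<in> \<phi> ` U" by blast
    qed
  qed
  have deriv: "frechet_derivative \<phi> (at u) v $ f k = v $ k" if "u \<in> U" for u v k
  proof -
    have "(\<lambda>u. \<phi> u $ f k) = (\<lambda>u. u $ k)" by (simp add: \<phi>_nth fc gf)
    moreover have "((\<lambda>u. u $ k) has_derivative (\<lambda>u. u $ k)) (at u)"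
      by (intro bounded_linear_imp_has_derivative bounded_linear_vec_nth)
    ultimately show ?thesis
      using smooth_map_has_derivative(2)[OF smooth that] frechet_derivative_at by metis
  qed
  have "homeomorphism U (\<phi> ` U) \<phi> \<psi>"
  proof (rule homeomorphismI)
    have "Ck_on 0 U (\<lambda>u. \<phi> u $ k)" for k
      using smooth unfolding smooth_map_on_def smooth_on_def by blast
    then have "continuous_on U (\<lambda>u. \<chi> k. \<phi> u $ k)"
      by (intro continuous_on_vec_lambda) simp
    then show "continuous_on U \<phi>" by simp
    show "continuous_on (\<phi> ` U) \<psi>"
      unfolding \<psi>_def by (intro continuous_intros)
  qed (auto simp: \<psi>\<phi>)
  moreover have "inj (frechet_derivative \<phi> (at u))" if "u \<in> U" for u
    using deriv[OF that] by (metis injI vec_eq_iff)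
  moreover have "openin (top_of_set SL) (\<phi> ` U)"
    using open_cof unfolding image openin_open by blast
  ultimately have "local_param SL U \<phi>"
    unfolding local_param_def using \<open>open U\<close> smooth in_SL by blast
  then show thesis using image deriv by (rule that)
qed

text \<open>
  Differentiating \<open>det = 1\<close> along a parametrization puts every tangent vector into the kernel of the
  differential of \<open>det\<close>.  Conversely, a vector of this kernel is determined by its entries other than \<open>c\<close> if the
  cofactor at \<open>c\<close> is nonzero, and the chart solving for that entry realizes all such entries.  The latter shows
  also that a single chart has the whole tangent space as the range of its derivative.
\<close>

lemma tangent_space_SL:
  fixes x :: "'k::real_normed_field ^ ('n::finite \<times> 'n)"
  assumes card: "CARD('d::finite) = CARD('n)\<^sup>2 - 1" and x: "x \<in> SL"
  obtains U and \<phi> :: "'k ^ 'd \<Rightarrow> 'k ^ ('n \<times> 'n)" and u where "local_param SL U \<phi>" "u \<in> U" "\<phi> u = x"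
    "range (frechet_derivative \<phi> (at u)) = {v. (\<Sum>c\<in>UNIV. cofactor x c * v $ c) = 0}"
    "tangent_space TYPE('d) SL x = {v. (\<Sum>c\<in>UNIV. cofactor x c * v $ c) = 0}"
proof -
  let ?K = "{v. (\<Sum>c\<in>UNIV. cofactor x c * v $ c) = 0}"
  have sub: "range (frechet_derivative \<phi> (at u)) \<subseteq> ?K"
    if \<phi>: "local_param SL U \<phi>" and u: "u \<in> U" "\<phi> u = x" for U and \<phi> :: "'k ^ 'd \<Rightarrow> 'k ^ ('n \<times> 'n)" and u
  proof -
    have d: "(\<phi> has_derivative frechet_derivative \<phi> (at u)) (at u)"
      using \<phi> u by (intro smooth_map_has_derivative(1)) (auto simp: local_param_def)
    have "((\<lambda>y. det (entry_matrix (\<phi> y))) has_derivative (\<lambda>w. \<Sum>c\<in>UNIV. cofactor x c * frechet_derivative \<phi> (at u) w $ c)) (at u)"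
      by (rule has_derivative_compose[OF d]) (use det_has_derivative[of x] u in simp)
    moreover have "((\<lambda>y. det (entry_matrix (\<phi> y))) has_derivative (\<lambda>w. 0)) (at u)"
    proof (rule has_derivative_transform_within_open[of "\<lambda>_. 1" _ _ _ U])
      show "1 = det (entry_matrix (\<phi> y))" if "y \<in> U" for y
        using \<phi> that unfolding local_param_def by (auto simp flip: in_SL_iff)
    qed (use \<phi> u in \<open>auto simp: local_param_def\<close>)
    ultimately have "(\<lambda>w. \<Sum>c\<in>UNIV. cofactor x c * frechet_derivative \<phi> (at u) w $ c) = (\<lambda>w. 0)"
      by (rule has_derivative_unique)
    then show ?thesis by (auto dest: fun_cong)
  qed
  \<comment> \<open>By Euler's identity some cofactor at \<open>x\<close> is nonzero.\<close>
  have "(\<Sum>c\<in>UNIV. cofactor x c * x $ c) \<noteq> 0"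
    using x by (simp add: cofactor_Euler in_SL_iff)
  then obtain c where "cofactor x c * x $ c \<noteq> 0"
    by (rule sum.not_neutral_contains_not_neutral)
  then have c: "cofactor x c \<noteq> 0" by auto
  have "CARD('d) = card (- {c})"
    using card by (simp add: Compl_eq_Diff_UNIV card_Diff_singleton power2_eq_square)
  then obtain f :: "'d \<Rightarrow> 'n \<times> 'n" where f: "bij_betw f UNIV (- {c})"
    using finite_same_card_bij[of "UNIV :: 'd set" "- {c}"] by auto
  define \<phi> where "\<phi> = (SL_chart c (inv_into UNIV f) :: 'k ^ 'd \<Rightarrow> 'k ^ ('n \<times> 'n))"
  obtain U where U: "local_param SL U \<phi>" "\<phi> ` U = SL \<inter> {x. cofactor x c \<noteq> 0}"
    "\<And>u v k. u \<in> U \<Longrightarrow> frechet_derivative \<phi> (at u) v $ f k = v $ k"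
    unfolding \<phi>_def by (rule SL_chart_local_param[OF f]) blast
  have "x \<in> \<phi> ` U" unfolding U(2) using x c by simp
  then obtain u where u: "u \<in> U" "\<phi> u = x" by auto
  have K: "range (frechet_derivative \<phi> (at u)) = ?K"
  proof
    show "?K \<subseteq> range (frechet_derivative \<phi> (at u))"
    proof
      fix v assume v: "v \<in> ?K"
      define v' where "v' = frechet_derivative \<phi> (at u) (\<chi> i. v $ f i)"
      have "v' \<in> ?K" using sub[OF U(1) u] by (auto simp: v'_def)
      have off: "v' $ k = v $ k" if "k \<noteq> c" for k
      proof -
        have "k \<in> range f" using f that by (simp add: bij_betw_def)
        then obtain i where "k = f i" by blast
        then show ?thesis using U(3)[OF u(1)] by (simp add: v'_def)
      qed
      have "(\<Sum>k\<in>UNIV. cofactor x k * v' $ k) - (\<Sum>k\<in>UNIV. cofactor x k * v $ k) = cofactor x c * (v' $ c - v $ c)"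
        by (simp add: sum.remove[of UNIV c] off algebra_simps)
      then have "v' $ c = v $ c" using v \<open>v' \<in> ?K\<close> c by simp
      then have "v' = v" using off by (metis vec_eq_iff)
      then show "v \<in> range (frechet_derivative \<phi> (at u))" by (metis v'_def rangeI)
    qed
  qed (rule sub[OF U(1) u])
  moreover have "tangent_space TYPE('d) SL x = ?K"
  proof
    show "tangent_space TYPE('d) SL x \<subseteq> ?K"
      using sub unfolding tangent_space_def by blast
    show "?K \<subseteq> tangent_space TYPE('d) SL x"
      unfolding K[symmetric] using local_param_tangent(2)[OF U(1) u(1)] u(2) by auto
  qed
  ultimately show thesis by (rule that[OF U(1) u])
qed

section \<open>The contact condition\<close>

text \<open>
  The value does not depend on the parametrization by \<open>ext_deriv_pullback_omega\<close>.  That some parametrization has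
  both vectors in the range of its derivative follows from \<open>tangent_space_SL\<close>.
\<close>

lemma ext_deriv_on_SL:
  fixes x :: "'k::real_normed_field ^ ('n::finite \<times> 'n)"
  assumes card: "CARD('d::finite) = CARD('n)\<^sup>2 - 1" and x: "x \<in> SL"
    and v: "\<And>i. i < 2 \<Longrightarrow> v i \<in> tangent_space TYPE('d) SL x"
  shows "ext_deriv_on TYPE('d) SL 1 (induced_form TYPE('d) 1 SL (omega p e)) x v = 2 * row_form p e (v 0) (v 1)"
  unfolding ext_deriv_on_def
proof (rule the_equality)
  obtain U and \<phi> :: "'k ^ 'd \<Rightarrow> 'k ^ ('n \<times> 'n)" and u where \<phi>: "local_param SL U \<phi>" "u \<in> U" "\<phi> u = x"
    "range (frechet_derivative \<phi> (at u)) = {v. (\<Sum>c\<in>UNIV. cofactor x c * v $ c) = 0}"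
    "tangent_space TYPE('d) SL x = {v. (\<Sum>c\<in>UNIV. cofactor x c * v $ c) = 0}"
    by (rule tangent_space_SL[OF card x])
  have "v 0 \<in> range (frechet_derivative \<phi> (at u))" "v 1 \<in> range (frechet_derivative \<phi> (at u))"
    unfolding \<phi>(4) \<phi>(5)[symmetric] by (rule v; simp)+
  then obtain w0 w1 where "frechet_derivative \<phi> (at u) w0 = v 0" "frechet_derivative \<phi> (at u) w1 = v 1"
    by (auto simp only: image_iff)
  moreover define w where "w i = (if i = 0 then w0 else w1)" for i :: nat
  ultimately have w: "\<forall>i\<le>1. frechet_derivative \<phi> (at u) (w i) = v i"
    by (auto simp: le_Suc_eq)
  then have "2 * row_form p e (v 0) (v 1) = ext_deriv 1 (pullback \<phi> (induced_form TYPE('d) 1 SL (omega p e))) u w"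
    by (simp only: ext_deriv_pullback_omega[OF \<phi>(1,2)] le0 order_refl)
  then show "\<exists>U (\<phi> :: 'k ^ 'd \<Rightarrow> 'k ^ ('n \<times> 'n)) u w. local_param SL U \<phi> \<and> u \<in> U \<and> \<phi> u = x \<and>
      (\<forall>i\<le>1. frechet_derivative \<phi> (at u) (w i) = v i) \<and>
      2 * row_form p e (v 0) (v 1) = ext_deriv 1 (pullback \<phi> (induced_form TYPE('d) 1 SL (omega p e))) u w"
    using \<phi> w by blast
qed (auto simp: ext_deriv_pullback_omega simp del: One_nat_def)

text \<open>
  The induced form is set to \<open>0\<close> off the tangent space, so its linearity rests on the tangent space being closed
  under linear combinations, which is clear from its description as a kernel.
\<close>

lemma differential_form_omega_SL:
  assumes card: "CARD('d::finite) = CARD('n::finite)\<^sup>2 - 1"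
  shows "differential_form_on TYPE('d) 1 (SL :: ('k::real_normed_field ^ ('n \<times> 'n)) set)
    (induced_form TYPE('d) 1 SL (omega p e))"
  unfolding differential_form_on_def
proof (intro conjI ballI allI impI)
  fix x :: "'k ^ ('n \<times> 'n)" assume x: "x \<in> SL"
  let ?T = "tangent_space TYPE('d) SL x"
  have T: "?T = {v. (\<Sum>c\<in>UNIV. cofactor x c * v $ c) = 0}"
    by (rule tangent_space_SL[OF card x])
  have "a + c *s b \<in> ?T" if "a \<in> ?T" "b \<in> ?T" for a b c
  proof -
    have "(\<Sum>k\<in>UNIV. cofactor x k * (a + c *s b) $ k) =
      (\<Sum>k\<in>UNIV. cofactor x k * a $ k) + c * (\<Sum>k\<in>UNIV. cofactor x k * b $ k)"
      by (simp add: sum_distrib_left sum.distrib[symmetric] algebra_simps)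
    then show ?thesis using that by (simp add: T)
  qed
  then show "alternating_on 1 ?T (induced_form TYPE('d) 1 SL (omega p e) x)"
    unfolding alternating_on_def
    by (auto simp: induced_form_def omega_eq_row_form x row_form.add_right row_form.scale_right)
next
  fix U and \<phi> :: "'k ^ 'd \<Rightarrow> 'k ^ ('n \<times> 'n)" and w
  assume \<phi>: "local_param SL U \<phi>"
  then have U: "open U" and sm: "smooth_map_on U \<phi>" by (auto simp: local_param_def)
  have eq: "row_form p e (\<phi> u) (\<chi> i. frechet_derivative (\<lambda>u. \<phi> u $ i) (at u) (w 0)) =
    pullback \<phi> (induced_form TYPE('d) 1 SL (omega p e)) u w" if "u \<in> U" for u
  proof -
    have "\<phi> u \<in> SL" "frechet_derivative \<phi> (at u) (w 0) \<in> tangent_space TYPE('d) SL (\<phi> u)"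
      using local_param_tangent[OF \<phi> that] by blast+
    moreover have "(\<chi> i. frechet_derivative (\<lambda>u. \<phi> u $ i) (at u) (w 0)) = frechet_derivative \<phi> (at u) (w 0)"
      by (simp add: vec_eq_iff smooth_map_has_derivative(2)[OF sm that])
    ultimately show ?thesis by (simp add: pullback_def induced_form_def omega_eq_row_form)
  qed
  have "smooth_on U (\<lambda>u. \<phi> u $ i)" for i using sm unfolding smooth_map_on_def by blast
  then have "Ck_on n U (\<lambda>u. \<phi> u $ i)" "Ck_on n U (\<lambda>u. frechet_derivative (\<lambda>u. \<phi> u $ i) (at u) (w 0))" for n i
    using smooth_on_derivative[OF U] unfolding smooth_on_def by blast+
  then have Ck: "Ck_on n U (\<lambda>u. row_form p e (\<phi> u) (\<chi> i. frechet_derivative (\<lambda>u. \<phi> u $ i) (at u) (w 0)))" for n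
    unfolding row_form_def by (intro Ck_on_sum Ck_on_diff Ck_on_mult) simp_all
  then show "smooth_on U (\<lambda>u. pullback \<phi> (induced_form TYPE('d) 1 SL (omega p e)) u w)"
    unfolding smooth_on_def by (intro allI Ck_on_cong[OF U _ Ck]) (rule eq)
qed

text \<open>
  The second basis vector \<open>b\<^sub>1\<close> is a multiple of the vector that represents the differential of \<open>det\<close> through the
  bilinear form, and Euler's identity provides the normalization \<open>B(x, b\<^sub>1) = 1\<close>.  In a symplectic basis every vector
  other than \<open>b\<^sub>0\<close> is orthogonal to \<open>b\<^sub>1\<close>.
\<close>

lemma symplectic_basis_through_SL_point:
  fixes x :: "'k::real_normed_field ^ ('n::finite \<times> 'n)"
  assumes e: "bij_betw e {1..2 * p} UNIV" and x: "x \<in> SL" and m: "2 * Suc m = CARD('n)\<^sup>2"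
  obtains b where "row_form.symplectic_tuple p e (2 * Suc m) b" "b 0 = x"
    "\<And>i. 0 < i \<Longrightarrow> i < 2 * Suc m \<Longrightarrow> (\<Sum>c\<in>UNIV. cofactor x c * b i $ c) = 0"
proof -
  obtain n where n: "\<And>v. row_form p e n v = (\<Sum>c\<in>UNIV. cofactor x c * v $ c)"
    using row_form_represents[OF e] by metis
  define s where "s = row_form p e x n"
  have "s \<noteq> 0"
    using n[of x] row_form.skew[of p e x n] x by (simp add: s_def cofactor_Euler in_SL_iff)
  define y where "y = inverse s *s n"
  have xy: "row_form p e x y = 1" using \<open>s \<noteq> 0\<close> by (simp add: y_def s_def row_form.scale_right)
  have "2 * Suc m \<le> CARD('n \<times> 'n)" using m by (simp add: power2_eq_square)
  then obtain b where b: "row_form.symplectic_tuple p e (2 * Suc m) b" "b 0 = x" "b 1 = y"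
    using row_form.symplectic_basis_exists[OF row_form_nondegenerate[OF e] xy] by blast
  have "(\<Sum>c\<in>UNIV. cofactor x c * b i $ c) = 0" if "0 < i" "i < 2 * Suc m" for i
  proof -
    have "row_form p e y (b i) = of_int (symplectic_entry 1 i)"
      using b(1) that unfolding row_form.symplectic_tuple_def b(3)[symmetric] by simp
    also have "symplectic_entry 1 i = 0" using that by (auto simp: symplectic_entry_def)
    finally show ?thesis
      using \<open>s \<noteq> 0\<close> by (simp add: y_def row_form.scale_left n)
  qed
  then show thesis using b(1,2) that by blast
qed

lemma contact_form_omega_SL:
  fixes e :: "nat \<Rightarrow> 'n::finite"
  assumes p: "p \<ge> 1" and e: "bij_betw e {1..2 * p} UNIV" and card: "CARD('d::finite) = 4 * p ^ 2 - 1"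
  shows "contact_form TYPE('d) (SL :: ('k::real_normed_field ^ ('n \<times> 'n)) set)
    (induced_form TYPE('d) 1 SL (omega p e))"
  unfolding contact_form_def
proof (intro conjI exI[of _ "2 * p ^ 2 - 1"] ballI)
  have n: "CARD('n) = 2 * p" using bij_betw_same_card[OF e] by simp
  then have card': "CARD('d) = CARD('n)\<^sup>2 - 1" using card by (simp add: power2_eq_square)
  show "submanifold TYPE('d) (SL :: ('k ^ ('n \<times> 'n)) set)"
    unfolding submanifold_def
  proof
    fix x :: "'k ^ ('n \<times> 'n)" assume "x \<in> SL"
    obtain U and \<phi> :: "'k ^ 'd \<Rightarrow> 'k ^ ('n \<times> 'n)" and u where "local_param SL U \<phi>" "u \<in> U" "\<phi> u = x"
      by (rule tangent_space_SL[OF card' \<open>x \<in> SL\<close>])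
    then show "\<exists>U (\<phi> :: 'k ^ 'd \<Rightarrow> 'k ^ ('n \<times> 'n)). local_param SL U \<phi> \<and> x \<in> \<phi> ` U" by blast
  qed
  show "differential_form_on TYPE('d) 1 (SL :: ('k ^ ('n \<times> 'n)) set) (induced_form TYPE('d) 1 SL (omega p e))"
    by (rule differential_form_omega_SL[OF card'])
  define m where "m = 2 * p ^ 2 - 1"
  have "p ^ 2 \<ge> 1" using p by simp
  then have m: "2 * Suc m = CARD('n)\<^sup>2" by (simp add: m_def n power2_eq_square)
  show "CARD('d) = 2 * (2 * p ^ 2 - 1) + 1" using m card' by (simp add: m_def)
  fix x :: "'k ^ ('n \<times> 'n)" assume x: "x \<in> SL"
  let ?\<alpha> = "induced_form TYPE('d) 1 SL (omega p e) :: ('k, 'n \<times> 'n) dform"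
  let ?\<beta> = "ext_deriv_on TYPE('d) SL 1 ?\<alpha>"
  let ?T = "tangent_space TYPE('d) SL x"
  have T: "?T = {v. (\<Sum>c\<in>UNIV. cofactor x c * v $ c) = 0}"
    by (rule tangent_space_SL[OF card' x])
  obtain b0 where b0: "row_form.symplectic_tuple p e (2 * Suc m) b0" "b0 0 = x"
    "\<And>i. 0 < i \<Longrightarrow> i < 2 * Suc m \<Longrightarrow> (\<Sum>c\<in>UNIV. cofactor x c * b0 i $ c) = 0"
    by (rule symplectic_basis_through_SL_point[OF e x m]) blast
  \<comment> \<open>Zero is tangent, so beyond the basis the tuple consists of tangent vectors too.\<close>
  define b where "b i = (if i < 2 * Suc m then b0 i else 0)" for i
  have bT: "b (Suc i) \<in> ?T" for i
    using b0(3)[of "Suc i"] by (simp add: T b_def)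
  have "wedge 1 (2 * m) ?\<alpha> (wedge_pow 2 ?\<beta> m) x (\<lambda>i. b (Suc i)) \<noteq> 0"
  proof (rule contact_product_on_symplectic_basis[where T = ?T and B = "row_form p e"])
    show "?\<beta> x v = 2 * row_form p e (v 0) (v 1)" if "\<And>i. v i \<in> ?T" for v
      using ext_deriv_on_SL[OF card' x] that by blast
    show "?\<beta> x v = ?\<beta> x w" if "v 0 = w 0" "v 1 = w 1" for v w
      by (rule ext_deriv_on_cong) (use that in \<open>auto simp: le_Suc_eq\<close>)
    show "?\<alpha> x v = row_form p e (b 0) (v 0)" if "\<And>i. v i \<in> ?T" for v
      using that x by (simp add: induced_form_def omega_eq_row_form b_def b0(2))
    show "?\<alpha> x v = ?\<alpha> x w" if "v 0 = w 0" for v w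
      by (simp add: induced_form_def omega_eq_row_form that)
    show "b (Suc i) \<in> ?T" for i by (rule bT)
    show "row_form p e (b i) (b j) = of_int (symplectic_entry i j)" if "i < 2 * Suc m" "j < 2 * Suc m" for i j
      using b0(1) that by (simp add: row_form.symplectic_tuple_def b_def)
  qed
  then show "\<exists>v. (\<forall>i<2 * (2 * p ^ 2 - 1) + 1. v i \<in> ?T) \<and>
    wedge 1 (2 * (2 * p ^ 2 - 1)) ?\<alpha> (wedge_pow 2 ?\<beta> (2 * p ^ 2 - 1)) x v \<noteq> 0"
    using bT unfolding m_def by (intro exI[of _ "\<lambda>i. b (Suc i)"] conjI allI impI)
qed

theorem theorem7:
  fixes p :: nat and e :: "nat \<Rightarrow> 'n::finite"
  assumes "p \<ge> 1"
    and "bij_betw e {1..2 * p} UNIV"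
    and "CARD('d::finite) = 4 * p ^ 2 - 1"
  shows "contact_form TYPE('d) (SL :: (real ^ ('n \<times> 'n)) set)
           (induced_form TYPE('d) 1 SL (omega p e)) \<and>
         contact_form TYPE('d) (SL :: (complex ^ ('n \<times> 'n)) set)
           (induced_form TYPE('d) 1 SL (omega p e))"
  by (intro conjI contact_form_omega_SL[OF assms])

end
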